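(* Let $q$ be a real number with $1<q\le\sqrt{2}$ which is not a Pisot number. Then the set $A(q)$ is dense in $\mathbb{R}$.
   Context: For a real number $1<q\le 2$, $A(q)=\left\{\sum_{i=0}^n a_iq^i : n\in\{0,1,2,\ldots\},\ a_0,\ldots,a_n\in\{-1,1\}\right\}$. A Pisot number is a real algebraic integer $>1$ all of whose other algebraic conjugates have modulus strictly less than one. *)

theory Defs
  imports "HOL-Analysis.Analysis" "HOL-Computational_Algebra.Computational_Algebra"
begin

definition signed_sums :: "real \<Rightarrow> real set" where
  "signed_sums q = {\<Sum>i\<le>n. a i * q ^ i | (a :: nat \<Rightarrow> real) (n :: nat). \<forall>i\<le>n. a i \<in> {-1, 1}}"

(* The minimal polynomial of x over the rationals is the monic irreducible rational polynomial
   vanishing at x. Given as a relation: no such polynomial exists when x is transcendental. *)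
definition is_min_poly :: "rat poly \<Rightarrow> complex \<Rightarrow> bool" where
  "is_min_poly p x \<longleftrightarrow> lead_coeff p = 1 \<and> irreducible p \<and> poly (map_poly of_rat p) x = 0"

(* All complex roots of the minimal polynomial of x, x itself included. *)
definition conjugates :: "complex \<Rightarrow> complex set" where
  "conjugates x = {y. \<exists>p. is_min_poly p x \<and> poly (map_poly of_rat p) y = 0}"

definition pisot :: "real \<Rightarrow> bool" where
  "pisot q \<longleftrightarrow> algebraic_int q \<and> q > 1 \<and>
     (\<forall>z \<in> conjugates (complex_of_real q) - {complex_of_real q}. cmod z < 1)"

end

theory Submission
  imports Defs "HOL-Real_Asymp.Real_Asymp"
begin

text \<open>Put \<open>Q = q\<^sup>2 \<le> 2\<close> and suppose that the signed sums are not dense. If sums of powers of \<open>Q\<close>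
  with coefficients in \<open>{-1,0,1}\<close> came arbitrarily close to \<open>0\<close>, then flipping the signs of blocks of
  even powers of \<open>q\<close> would give arbitrarily fine steps, and the odd powers, whose sums have
  bounded gaps because \<open>Q \<le> 2\<close>, would spread them over the whole line. So \<open>0\<close> is isolated in this
  spectrum of \<open>Q\<close>. For \<open>Q < 2\<close> an argument of Feng shows that the spectrum is locally finite, and
  then \<open>Q\<close> is a Pisot number (Akiyama and Komornik): an expansion of \<open>0\<close> in base \<open>Q\<close> must
  remain an expansion of \<open>0\<close> at every conjugate outside the unit disc, which a suitable choice
  of digit signs prevents. As \<open>q\<close> is not a Pisot number, its only conjugate outside the open unit disc
  is \<open>-q\<close>, so \<open>1\<close> and \<open>q\<close> are linearly independent over \<open>\<int>[Q]\<close>, and density follows from a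
  pigeonhole argument for the pairs (even part, odd part).\<close>

section \<open>Integer polynomials, digit sums and conjugates\<close>

text \<open>Isolation of \<open>0\<close> in the spectrum of \<open>Q\<close> is an obstacle as well
  as a gain: fine steps then have to mix even and odd powers of \<open>q\<close>, so no free powers
  are left to spread them over the line. Room is made by scaling: multiplication by a power of
  \<open>Q\<close> frees low digits, whose sums have gaps at most \<open>1\<close>, and this works
  only for a chain of fine steps that is long compared with its largest gap. Here the Pisot property
  of \<open>Q\<close> enters: at the other conjugates digit sums are bounded independently of their
  length, so rounding leaves finitely many errors and a colouring argument applies. The conjugate
  \<open>-q\<close> arises as follows: a conjugate \<open>z\<close> of \<open>q\<close> outside the
  open unit disc has a square conjugate to \<open>Q\<close>, hence equal to \<open>Q\<close>. A
  relation \<open>F(Q) + q * G(Q) = 0\<close> then also holds with \<open>-q\<close>, so both terms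
  vanish. Feng's argument compares windows of radius \<open>1 / (Q - 1)\<close> with gaps of length
  \<open>1\<close>, whence \<open>Q < 2\<close>; for \<open>Q = 2\<close> it suffices that
  \<open>2\<close> has no other conjugate.\<close>

definition ieval :: "int poly \<Rightarrow> 'a::field_char_0 \<Rightarrow> 'a" where
  "ieval F z = poly (map_poly of_int F) z"

lemma ieval_0 [simp]: "ieval 0 z = 0"
  by (simp add: ieval_def)

lemma ieval_pCons [simp]: "ieval (pCons a F) z = of_int a + z * ieval F z"
  by (simp add: ieval_def map_poly_pCons)

lemma ieval_1 [simp]: "ieval 1 z = 1"
  by (simp add: ieval_def)

lemma ieval_add [simp]: "ieval (F + G) z = ieval F z + ieval G z"
  by (induction F G rule: poly_induct2) (simp_all add: algebra_simps)

lemma ieval_minus [simp]: "ieval (- F) z = - ieval F z"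
  by (induction F) (simp_all add: algebra_simps)

lemma ieval_diff [simp]: "ieval (F - G) z = ieval F z - ieval G z"
  using ieval_add[of F "- G" z] by simp

lemma ieval_smult [simp]: "ieval (smult a F) z = of_int a * ieval F z"
  by (induction F) (simp_all add: algebra_simps)

lemma ieval_mult [simp]: "ieval (F * G) z = ieval F z * ieval G z"
  by (induction F) (simp_all add: algebra_simps)

lemma ieval_monom [simp]: "ieval (monom a n) z = of_int a * z ^ n"
  by (simp add: ieval_def map_poly_monom poly_monom)

lemma ieval_of_real [simp]:
  "ieval F (of_real x :: 'a::{field_char_0,real_algebra_1}) = of_real (ieval F x)"
  by (induction F) simp_all

lemma ieval_pcompose [simp]: "ieval (pcompose F G) z = ieval F (ieval G z)"
  by (induction F) (simp_all add: pcompose_pCons algebra_simps)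

lemma ieval_sum_coeff:
  assumes "\<forall>i\<ge>n. coeff F i = 0"
  shows "ieval F z = (\<Sum>i<n. of_int (coeff F i) * z ^ i)"
  using assms
proof (induction F arbitrary: n)
  case 0
  then show ?case by simp
next
  case (pCons a F)
  show ?case
  proof (cases n)
    case 0
    with pCons have "pCons a F = 0" by (simp add: poly_eq_iff)
    then show ?thesis using 0 by simp
  next
    case (Suc m)
    have "\<forall>i\<ge>m. coeff F i = 0"
    proof (intro allI impI)
      fix i assume "m \<le> i"
      then show "coeff F i = 0" using pCons.prems[rule_format, of "Suc i"] Suc by simp
    qed
    from pCons.IH[OF this] show ?thesis
      unfolding Suc by (simp add: sum.lessThan_Suc_shift sum_distrib_left mult_ac del: sum.lessThan_Suc)
  qed
qed

text \<open>Conjugacy as equality of the sets of integer relations: identities between integer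
  polynomials transfer in both directions, with no minimal polynomial to carry along.\<close>

definition alg_conj :: "complex \<Rightarrow> complex \<Rightarrow> bool" where
  "alg_conj x y \<longleftrightarrow> (\<forall>F. ieval F x = 0 \<longleftrightarrow> ieval F y = 0)"

lemma alg_conj_eq_iff: "alg_conj x y \<Longrightarrow> ieval F x = ieval G x \<longleftrightarrow> ieval F y = ieval G y"
  unfolding alg_conj_def using ieval_diff by (metis right_minus_eq)

lemma alg_conj_power2: "alg_conj x y \<Longrightarrow> alg_conj (x\<^sup>2) (y\<^sup>2)"
  unfolding alg_conj_def
proof
  fix F assume h: "\<forall>F. ieval F x = 0 \<longleftrightarrow> ieval F y = 0"
  show "ieval F (x\<^sup>2) = 0 \<longleftrightarrow> ieval F (y\<^sup>2) = 0"
    using h[rule_format, of "pcompose F (monom 1 2)"] by simp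
qed

text \<open>A nonzero rational polynomial of least degree vanishing at a root \<open>w\<close> of
  the irreducible \<open>p\<close> divides \<open>p\<close> by Euclidean division and is not
  constant, so it is associated with \<open>p\<close>. Hence vanishing at \<open>w\<close> means
  divisibility by \<open>p\<close>, whichever root \<open>w\<close> is.\<close>

lemma conjugates_imp_alg_conj:
  assumes "z \<in> conjugates x"
  shows "alg_conj x z"
proof -
  obtain p where p: "lead_coeff p = 1" "irreducible p" "poly (map_poly of_rat p) x = 0"
      "poly (map_poly of_rat p) z = 0"
    using assms by (auto simp: conjugates_def is_min_poly_def)
  define rv :: "rat poly \<Rightarrow> complex \<Rightarrow> complex" where "rv G w = poly (map_poly of_rat G) w" for G w
  have [simp]: "rv 0 w = 0" "rv 1 w = 1" "rv (pCons a G) w = of_rat a + w * rv G w" for w a G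
    by (simp_all add: rv_def map_poly_pCons)
  have add: "rv (G + H) w = rv G w + rv H w" for G H w
    by (induction G H rule: poly_induct2) (simp_all add: algebra_simps of_rat_add)
  have smult: "rv (smult a G) w = of_rat a * rv G w" for a G w
    by (induction G) (simp_all add: algebra_simps of_rat_mult)
  have mult: "rv (G * H) w = rv G w * rv H w" for G H w
    by (induction G) (simp_all add: algebra_simps add smult)
  have iv: "ieval F w = rv (map_poly of_int F) w" for F w
    by (induction F) (simp_all add: map_poly_pCons)
  have dvd: "p dvd G" if G: "rv G w = 0" and w: "rv p w = 0" for G w
  proof -
    have p0: "p \<noteq> 0" using p(1) by auto
    obtain D where D: "D \<noteq> 0" "rv D w = 0"
      "\<And>E. E \<noteq> 0 \<Longrightarrow> rv E w = 0 \<Longrightarrow> degree D \<le> degree E"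
      using ex_has_least_nat[of "\<lambda>E. E \<noteq> 0 \<and> rv E w = 0" p degree] p0 w by blast
    have D_dvd: "D dvd E" if "rv E w = 0" for E
    proof -
      have "rv (E div D * D + E mod D) w = 0" using that by simp
      then have "rv (E mod D) w = 0" using D(2) by (simp only: add mult) simp
      then have "E mod D = 0" using degree_mod_less[OF D(1), of E] D(3)[of "E mod D"] by linarith
      then show ?thesis by auto
    qed
    then obtain H where H: "p = D * H" using w by blast
    have "\<not> is_unit D"
    proof
      assume "is_unit D"
      then obtain c where "D = [:c:]" "c \<noteq> 0" by (auto simp: is_unit_poly_iff dvd_field_iff)
      with D(2) show False by simp
    qed
    then have "is_unit H" using p(2) H irreducibleD by blast
    then have "p dvd D" using H by (metis dvd_refl mult_unit_dvd_iff)
    then show ?thesis using D_dvd[OF G] dvd_trans by blast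
  qed
  have "rv G w = 0" if "p dvd G" "rv p w = 0" for G w
    using that by (auto elim!: dvdE simp: mult)
  with dvd p(3,4) show ?thesis
    unfolding alg_conj_def iv by (metis rv_def)
qed

text \<open>A digit string with the lowest digit first. The length is a parameter separate from the
  degree because top digits may be \<open>0\<close>.\<close>

definition digit_polys :: "int set \<Rightarrow> nat \<Rightarrow> int poly set" where
  "digit_polys A n = {F. (\<forall>i<n. coeff F i \<in> A) \<and> (\<forall>i\<ge>n. coeff F i = 0)}"

lemma digit_polys_0 [simp]: "digit_polys A 0 = {0}"
  by (auto simp: digit_polys_def poly_eq_iff)

lemma digit_polys_pCons [simp]:
  "pCons a F \<in> digit_polys A (Suc n) \<longleftrightarrow> a \<in> A \<and> F \<in> digit_polys A n"
  unfolding digit_polys_def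
  by (auto simp: coeff_pCons split: nat.splits)

lemma digit_polys_Suc: "digit_polys A (Suc n) = (\<Union>a\<in>A. pCons a ` digit_polys A n)"
proof (intro set_eqI iffI)
  fix F assume "F \<in> digit_polys A (Suc n)"
  then show "F \<in> (\<Union>a\<in>A. pCons a ` digit_polys A n)" by (cases F) auto
qed auto

lemma finite_digit_polys: "finite A \<Longrightarrow> finite (digit_polys A n)"
  by (induction n) (auto simp: digit_polys_Suc)

lemma digit_polys_append:
  assumes "F \<in> digit_polys A n" "G \<in> digit_polys A k"
  shows "F + monom 1 n * G \<in> digit_polys A (n + k)"
  using assms by (auto simp: digit_polys_def coeff_monom_mult)

lemma digit_polys_diff:
  assumes "F \<in> digit_polys {0,1} n" "G \<in> digit_polys {0,1} n"
  shows "F - G \<in> digit_polys {-1,0,1} n"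
  using assms by (fastforce simp: digit_polys_def)

lemma digit_polys_mono: "A \<subseteq> B \<Longrightarrow> digit_polys A n \<subseteq> digit_polys B n"
  by (auto simp: digit_polys_def)

lemma digit_polys_mono_degree:
  "0 \<in> A \<Longrightarrow> n \<le> m \<Longrightarrow> digit_polys A n \<subseteq> digit_polys A m"
  unfolding digit_polys_def by (auto, metis leI)

lemma digit_polys_diffE:
  assumes "F \<in> digit_polys {-1,0,1} n"
  obtains G H where "G \<in> digit_polys {0,1} n" "H \<in> digit_polys {0,1} n" "F = G - H"
  using assms
proof (induction n arbitrary: F thesis)
  case 0
  then show ?case by auto
next
  case (Suc n)
  from Suc.prems(2) obtain a E where E: "a \<in> {-1,0,1}" "E \<in> digit_polys {-1,0,1} n" "F = pCons a E"
    by (auto simp: digit_polys_Suc)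
  from Suc.IH[OF _ E(2)] obtain G H where
    GH: "G \<in> digit_polys {0,1} n" "H \<in> digit_polys {0,1} n" "E = G - H" by blast
  show ?case
    using E GH by (intro Suc.prems(1)[of "pCons (max a 0) G" "pCons (max (-a) 0) H"]) auto
qed

text \<open>Uniformity in the length \<open>n\<close> is the point: it is how conjugates inside the
  unit disc control digit sums of any size.\<close>

lemma norm_digit_poly_le:
  fixes z :: complex
  assumes "F \<in> digit_polys {-1,0,1} n" "norm z < 1"
  shows "norm (ieval F z) \<le> 1 / (1 - norm z)"
  using assms(1)
proof (induction n arbitrary: F)
  case 0
  then show ?case using assms(2) by simp
next
  case (Suc n)
  then obtain a E where E: "a \<in> {-1,0,1}" "E \<in> digit_polys {-1,0,1} n" "F = pCons a E"
    by (auto simp: digit_polys_Suc)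
  have "norm (ieval F z) \<le> 1 + norm z * norm (ieval E z)"
    unfolding E(3) ieval_pCons using E(1)
    by (intro norm_triangle_mono) (auto simp: norm_mult)
  also have "\<dots> \<le> 1 + norm z * (1 / (1 - norm z))"
    using Suc.IH[OF E(2)] by (intro add_left_mono mult_left_mono) auto
  also have "\<dots> = 1 / (1 - norm z)" using assms(2) by (simp add: field_simps)
  finally show ?case .
qed

section \<open>Digit sums with digits 0 and 1, and their passage to signed sums\<close>

definition dsums :: "real \<Rightarrow> nat \<Rightarrow> real set" where
  "dsums b n = (\<lambda>F. ieval F b) ` digit_polys {0,1} n"

definition dmax :: "real \<Rightarrow> nat \<Rightarrow> real" where
  "dmax b n = (\<Sum>i<n. b ^ i)"

lemma dmax_0 [simp]: "dmax b 0 = 0"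
  by (simp add: dmax_def)

lemma dmax_Suc: "dmax b (Suc n) = 1 + b * dmax b n"
  by (simp add: dmax_def sum.lessThan_Suc_shift sum_distrib_left del: sum.lessThan_Suc)

lemma dmax_nonneg: "0 \<le> b \<Longrightarrow> 0 \<le> dmax b n"
  by (simp add: dmax_def sum_nonneg)

lemma dmax_eq: "b \<noteq> 1 \<Longrightarrow> dmax b n = (b ^ n - 1) / (b - 1)"
  unfolding dmax_def using geometric_sum[of b n] by simp

lemma dmax_add: "dmax b (n + k) = dmax b n + b ^ n * dmax b k"
  by (induction n) (simp_all add: dmax_Suc algebra_simps)

lemma filterlim_dmax:
  assumes "1 < b"
  shows "filterlim (dmax b) at_top sequentially"
proof -
  have "filterlim (\<lambda>n. (b ^ n - 1) / (b - 1)) at_top sequentially"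
    using assms by real_asymp
  moreover have "dmax b n = (b ^ n - 1) / (b - 1)" for n
    using assms by (simp add: dmax_eq)
  ultimately show ?thesis by presburger
qed

lemma dsums_0 [simp]: "dsums b 0 = {0}"
  by (simp add: dsums_def)

lemma dsums_Suc: "dsums b (Suc n) = (\<lambda>x. b * x) ` dsums b n \<union> (\<lambda>x. 1 + b * x) ` dsums b n"
  by (auto simp: dsums_def digit_polys_Suc image_Un image_image)

lemma finite_dsums: "finite (dsums b n)"
  by (simp add: dsums_def finite_digit_polys)

lemma dsums_bounds:
  assumes "0 \<le> b" "x \<in> dsums b n"
  shows "0 \<le> x" "x \<le> dmax b n"
proof -
  have "0 \<le> x \<and> x \<le> dmax b n"
    using assms(2)
  proof (induction n arbitrary: x)
    case (Suc n)
    then obtain y where "y \<in> dsums b n" "x = b * y \<or> x = 1 + b * y"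
      by (auto simp: dsums_Suc)
    with Suc.IH[of y] assms(1) show ?case
      using mult_left_mono[of y "dmax b n" b] by (auto simp: dmax_Suc)
  qed simp
  then show "0 \<le> x" "x \<le> dmax b n" by auto
qed

lemma zero_in_dsums: "0 \<in> dsums b n"
  by (induction n) (auto simp: dsums_Suc image_iff)

lemma dmax_in_dsums: "dmax b n \<in> dsums b n"
  by (induction n) (auto simp: dsums_Suc dmax_Suc)

lemma dsums_append:
  assumes "x \<in> dsums b n" "y \<in> dsums b k"
  shows "x + b ^ n * y \<in> dsums b (n + k)"
proof -
  obtain F G where "F \<in> digit_polys {0,1} n" "G \<in> digit_polys {0,1} k" "x = ieval F b" "y = ieval G b"
    using assms by (auto simp: dsums_def)
  then show ?thesis unfolding dsums_def
    by (intro image_eqI[of _ _ "F + monom 1 n * G"] digit_polys_append) simp_all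
qed

lemma dsums_diffE:
  assumes "x \<in> dsums b n" "y \<in> dsums b n"
  obtains F where "F \<in> digit_polys {-1,0,1} n" "ieval F b = x - y"
proof -
  obtain G H where "G \<in> digit_polys {0,1} n" "H \<in> digit_polys {0,1} n" "x = ieval G b" "y = ieval H b"
    using assms by (auto simp: dsums_def)
  then show ?thesis using that[of "G - H"] digit_polys_diff by simp
qed

lemma dsums_mono: "n \<le> m \<Longrightarrow> dsums b n \<subseteq> dsums b m"
  unfolding dsums_def by (intro image_mono digit_polys_mono_degree) auto

text \<open>Approximating \<open>s / b\<close> to within \<open>1\<close> by the upper digits leaves
  an interval of length \<open>b \<le> 2\<close> after scaling; the lowest digit cuts it into pieces
  of length at most \<open>1\<close>. Above \<open>b * dmax b n\<close> the string with lowest digit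
  \<open>0\<close> and all others \<open>1\<close> serves.\<close>

lemma dsums_approx:
  assumes b: "1 < b" "b \<le> 2" and s: "0 \<le> s" "s \<le> dmax b n"
  obtains x where "x \<in> dsums b n" "x \<le> s" "s \<le> x + 1"
proof -
  have "\<exists>x\<in>dsums b n. x \<le> s \<and> s \<le> x + 1"
    using s
  proof (induction n arbitrary: s)
    case (Suc n)
    show ?case
    proof (cases "s \<le> b * dmax b n")
      case True
      then have "s / b \<le> dmax b n" "0 \<le> s / b" using b Suc.prems by (auto simp: field_simps)
      from Suc.IH[OF this(2,1)] obtain x where x: "x \<in> dsums b n" "x \<le> s / b" "s / b \<le> x + 1" by blast
      then have "b * x \<le> s" "s \<le> b * x + b" using b by (auto simp: field_simps)
      then have "b * x \<le> s \<and> s \<le> b * x + 1 \<or> 1 + b * x \<le> s \<and> s \<le> 1 + b * x + 1"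
        using b by linarith
      then show ?thesis using x(1) by (auto simp: dsums_Suc)
    next
      case False
      then show ?thesis using Suc.prems dmax_in_dsums[of b n]
        by (intro bexI[of _ "b * dmax b n"]) (auto simp: dsums_Suc dmax_Suc)
    qed
  qed simp
  then show ?thesis using that by blast
qed

text \<open>Interleaving: the digits of \<open>x\<close> go to the even powers of \<open>q\<close>,
  those of \<open>y\<close> to the odd ones.\<close>

lemma dsums_even_odd:
  assumes "x \<in> dsums (q\<^sup>2) n" "y \<in> dsums (q\<^sup>2) n"
  shows "x + q * y \<in> dsums q (2 * n)"
  using assms
proof (induction n arbitrary: x y)
  case (Suc n)
  obtain u d where u: "u \<in> dsums (q\<^sup>2) n" "d \<in> {0,1}" "x = d + q\<^sup>2 * u"
    using Suc.prems(1) by (force simp: dsums_Suc)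
  obtain v e where v: "v \<in> dsums (q\<^sup>2) n" "e \<in> {0,1}" "y = e + q\<^sup>2 * v"
    using Suc.prems(2) by (force simp: dsums_Suc)
  have "x + q * y = d + q * (e + q * (u + q * v))"
    using u v by (simp add: algebra_simps power2_eq_square)
  moreover have "u + q * v \<in> dsums q (2 * n)" using Suc.IH u v by blast
  ultimately show ?case using u(2) v(2) by (auto simp: dsums_Suc)
qed simp

lemma dmax_even: "dmax q (2 * n) = (1 + q) * dmax (q\<^sup>2) n"
  by (induction n) (simp_all add: dmax_Suc algebra_simps power2_eq_square)

text \<open>A digit \<open>d\<close> becomes the sign \<open>2 * d - 1\<close>.\<close>

lemma dsums_imp_signed_sums:
  assumes "x \<in> dsums q (Suc n)"
  shows "2 * x - dmax q (Suc n) \<in> signed_sums q"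
proof -
  obtain F where F: "F \<in> digit_polys {0,1} (Suc n)" "x = ieval F q"
    using assms by (auto simp: dsums_def)
  have "x = (\<Sum>i\<le>n. of_int (coeff F i) * q ^ i)"
    using ieval_sum_coeff[of "Suc n" F q] F by (simp add: digit_polys_def lessThan_Suc_atMost)
  then have "2 * x - dmax q (Suc n) = (\<Sum>i\<le>n. (2 * of_int (coeff F i) - 1) * q ^ i)"
    by (simp add: dmax_def lessThan_Suc_atMost sum_distrib_left sum_subtractf[symmetric] algebra_simps)
  moreover have "2 * real_of_int (coeff F i) - 1 \<in> {-1, 1}" if "i \<le> n" for i
  proof -
    have "coeff F i \<in> {0, 1}" using F(1) that by (auto simp: digit_polys_def)
    then show ?thesis by auto
  qed
  ultimately show ?thesis unfolding signed_sums_def mem_Collect_eq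
    by (intro exI[of _ "\<lambda>i. 2 * real_of_int (coeff F i) - 1"] exI[of _ n] conjI allI impI)
qed

text \<open>The target \<open>y\<close> is pulled back through
  \<open>x \<mapsto> 2 * x - dmax q n\<close>; \<open>n > 0\<close> because a signed sum has at
  least one term.\<close>

lemma dense_signed_sumsI:
  assumes "\<And>\<epsilon> y. 0 < \<epsilon> \<Longrightarrow>
    \<exists>n>0. \<exists>x\<in>dsums q n. \<bar>x - (y + dmax q n) / 2\<bar> \<le> \<epsilon>"
  shows "closure (signed_sums q) = UNIV"
proof -
  have "y \<in> closure (signed_sums q)" for y
    unfolding closure_approachable
  proof (intro allI impI)
    fix e :: real assume "0 < e"
    then obtain n x where nx: "n > 0" "x \<in> dsums q n" "\<bar>x - (y + dmax q n) / 2\<bar> \<le> e / 3"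
      using assms[of "e / 3" y] by auto
    then obtain m where "n = Suc m" by (cases n) auto
    with nx have mem: "2 * x - dmax q n \<in> signed_sums q" using dsums_imp_signed_sums by blast
    have "2 * x - dmax q n - y = 2 * (x - (y + dmax q n) / 2)" by (simp add: field_simps)
    then have "\<bar>2 * x - dmax q n - y\<bar> = 2 * \<bar>x - (y + dmax q n) / 2\<bar>" by (simp only: abs_mult)
    also have "\<dots> \<le> 2 * (e / 3)" using nx(3) by (intro mult_left_mono) auto
    also have "\<dots> < e" using \<open>0 < e\<close> by simp
    finally have "dist (2 * x - dmax q n) y < e" by (simp only: dist_real_def)
    with mem show "\<exists>z\<in>signed_sums q. dist z y < e" by blast
  qed
  then show ?thesis by auto
qed

text \<open>Brown's lemma: van der Waerden's theorem with bounded gaps in place of arithmetic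
  progressions.\<close>

lemma monochromatic_syndetic:
  fixes L :: nat
  obtains R where "\<And>(col :: nat \<Rightarrow> 'c) s. card (col ` {s..s + R}) \<le> r \<Longrightarrow>
    \<exists>K u a. 1 \<le> K \<and> K \<le> R \<and> s \<le> u \<and> u + L * K + K \<le> s + R \<and>
      (\<forall>t\<in>{u..u + L * K}. \<exists>j\<in>{t..t + K}. col j = a)"
proof -
  have "\<exists>R. \<forall>(col :: nat \<Rightarrow> 'c) s. card (col ` {s..s + R}) \<le> r \<longrightarrow>
    (\<exists>K u a. 1 \<le> K \<and> K \<le> R \<and> s \<le> u \<and> u + L * K + K \<le> s + R \<and>
      (\<forall>t\<in>{u..u + L * K}. \<exists>j\<in>{t..t + K}. col j = a))"
  proof (induction r)
    case 0
    show ?case by (rule exI[of _ 0]) auto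
  next
    case (Suc r)
    then obtain R where R: "\<And>(col :: nat \<Rightarrow> 'c) s. card (col ` {s..s + R}) \<le> r \<Longrightarrow>
      \<exists>K u a. 1 \<le> K \<and> K \<le> R \<and> s \<le> u \<and> u + L * K + K \<le> s + R \<and>
        (\<forall>t\<in>{u..u + L * K}. \<exists>j\<in>{t..t + K}. col j = a)" by blast
    define K where "K = Suc R"
    show ?case
    proof (rule exI[of _ "L * K + K"], intro allI impI)
      fix col :: "nat \<Rightarrow> 'c" and s
      assume c: "card (col ` {s..s + (L * K + K)}) \<le> Suc r"
      show "\<exists>K' u a. 1 \<le> K' \<and> K' \<le> L * K + K \<and> s \<le> u \<and> u + L * K' + K' \<le> s + (L * K + K) \<and>
        (\<forall>t\<in>{u..u + L * K'}. \<exists>j\<in>{t..t + K'}. col j = a)"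
      \<comment> \<open>Either the colour of \<open>s\<close> meets every window of length
        \<open>K\<close> starting in \<open>{s..s + L * K}\<close>, or one such window avoids it and
        so has at most \<open>r\<close> colours. All these windows fit into the range
        \<open>L * K + K\<close>.\<close>
      proof (cases "\<forall>t\<in>{s..s + L * K}. \<exists>j\<in>{t..t + K}. col j = col s")
        case True
        then show ?thesis by (intro exI[of _ K] exI[of _ s] exI[of _ "col s"]) (auto simp: K_def)
      next
        case False
        then obtain t where t: "s \<le> t" "t \<le> s + L * K" "\<forall>j\<in>{t..t + K}. col j \<noteq> col s" by auto
        have sub: "col ` {t..t + R} \<subseteq> col ` {s..s + (L * K + K)} - {col s}"
          using t by (auto simp: K_def)
        have "card (col ` {t..t + R}) \<le> card (col ` {s..s + (L * K + K)} - {col s})"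
          by (intro card_mono sub) auto
        also have "\<dots> \<le> r" using c by (subst card_Diff_singleton) auto
        finally obtain K' u a where *: "1 \<le> K'" "K' \<le> R" "t \<le> u" "u + L * K' + K' \<le> t + R"
          "\<forall>t\<in>{u..u + L * K'}. \<exists>j\<in>{t..t + K'}. col j = a" using R by metis
        then show ?thesis using t
          by (intro exI[of _ K'] exI[of _ u] exI[of _ a]) (auto simp: K_def)
      qed
    qed
  qed
  then show ?thesis using that by blast
qed

lemma separated_card_le:
  fixes S :: "real set"
  assumes "S \<subseteq> {l..l + D}" "0 < \<eta>" and D: "0 \<le> D"
    and "\<And>x y. x \<in> S \<Longrightarrow> y \<in> S \<Longrightarrow> x < y \<Longrightarrow> \<eta> \<le> y - x"
  shows "finite S" "real (card S) \<le> D / \<eta> + 1"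
proof -
  have inj: "inj_on (\<lambda>x. \<lfloor>(x - l) / \<eta>\<rfloor>) S"
  proof (rule inj_onI, rule ccontr)
    fix x y assume *: "x \<in> S" "y \<in> S" "\<lfloor>(x - l) / \<eta>\<rfloor> = \<lfloor>(y - l) / \<eta>\<rfloor>" "x \<noteq> y"
    have "\<eta> \<le> \<bar>x - y\<bar>" using assms(4)[of x y] assms(4)[of y x] * by (auto simp: abs_if)
    then have "1 \<le> \<bar>(x - l) / \<eta> - (y - l) / \<eta>\<bar>"
      using assms(2) by (simp add: diff_divide_distrib[symmetric] field_simps)
    with *(3) show False by linarith
  qed
  have im: "(\<lambda>x. \<lfloor>(x - l) / \<eta>\<rfloor>) ` S \<subseteq> {0..\<lfloor>D / \<eta>\<rfloor>}"
  proof
    fix z assume "z \<in> (\<lambda>x. \<lfloor>(x - l) / \<eta>\<rfloor>) ` S"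
    then obtain x where x: "x \<in> S" "z = \<lfloor>(x - l) / \<eta>\<rfloor>" by auto
    then have "0 \<le> x - l" "x - l \<le> D" using assms(1) by auto
    then have "0 \<le> (x - l) / \<eta>" "(x - l) / \<eta> \<le> D / \<eta>"
      using assms(2) by (auto intro!: divide_right_mono)
    then show "z \<in> {0..\<lfloor>D / \<eta>\<rfloor>}" using x(2) by (auto intro: floor_mono)
  qed
  show "finite S" using im inj by (meson finite_atLeastAtMost_int finite_imageD finite_subset)
  have "card S \<le> card {0..\<lfloor>D / \<eta>\<rfloor>}"
    using card_inj_on_le[OF inj im] by simp
  then have "card S \<le> nat (\<lfloor>D / \<eta>\<rfloor> + 1)" by simp
  moreover have "0 \<le> \<lfloor>D / \<eta>\<rfloor>" using assms(2) D by simp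
  ultimately show "real (card S) \<le> D / \<eta> + 1" by linarith
qed

section \<open>Small differences of digit sums\<close>

text \<open>Magnifies a tiny gap to the size \<open>\<epsilon>\<close> up to a factor
  \<open>b\<close>; the lower bound \<open>k0\<close> on the exponent keeps enough low digits
  free.\<close>

lemma scale_into_interval:
  fixes b d \<epsilon> :: real
  assumes "1 < b" "0 < d" "b ^ k0 * d \<le> \<epsilon>"
  obtains k where "k0 \<le> k" "b ^ k * d \<le> \<epsilon>" "\<epsilon> < b * (b ^ k * d)"
proof -
  obtain n where "\<epsilon> / d < b ^ n" using real_arch_pow assms(1) by blast
  also have "b ^ n \<le> b ^ (k0 + n)" using assms(1) by (intro power_increasing) auto
  finally have n: "\<epsilon> < b ^ (k0 + n) * d" using assms(2) by (simp add: pos_divide_less_eq)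
  define m where "m = (LEAST m. \<epsilon> < b ^ (k0 + m) * d)"
  have m: "\<epsilon> < b ^ (k0 + m) * d" unfolding m_def using n by (rule LeastI)
  with assms(3) obtain l where l: "m = Suc l" by (cases m) auto
  have "\<not> \<epsilon> < b ^ (k0 + l) * d" using l unfolding m_def by (metis lessI not_less_Least)
  then show ?thesis using m l by (intro that[of "k0 + l"]) (auto simp: mult_ac)
qed

text \<open>Each step of the chain switches one block of even powers. Steps are kept above
  \<open>\<epsilon> / Q\<close>, so a known number of them spans \<open>q\<close>, which bounds the
  gaps between the sums \<open>q * x\<close> over the odd powers.\<close>

lemma dense_if_small_even_differences:
  fixes q :: real
  assumes q: "1 < q" "q\<^sup>2 \<le> 2"
    and small: "\<And>\<eta>. 0 < \<eta> \<Longrightarrow> \<exists>n. \<exists>x\<in>dsums (q\<^sup>2) n. \<exists>y\<in>dsums (q\<^sup>2) n. 0 < x - y \<and> x - y < \<eta>"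
  shows "closure (signed_sums q) = UNIV"
proof (rule dense_signed_sumsI)
  fix \<epsilon> y :: real assume \<epsilon>: "0 < \<epsilon>"
  define Q where "Q = q\<^sup>2"
  have Q: "1 < Q" "Q \<le> 2" using q by (auto simp: Q_def power2_eq_square less_1_mult)
  have chain: "\<exists>N e. (\<forall>i\<le>m. e i \<in> dsums Q N) \<and>
      (\<forall>i<m. e (Suc i) - e i \<le> \<epsilon> \<and> \<epsilon> / Q < e (Suc i) - e i)" for m
  proof (induction m)
    case 0
    show ?case by (auto intro!: exI[of _ "\<lambda>_. 0"] zero_in_dsums)
  next
    case (Suc m)
    then obtain N e where e: "\<And>i. i \<le> m \<Longrightarrow> e i \<in> dsums Q N"
      "\<And>i. i < m \<Longrightarrow> e (Suc i) - e i \<le> \<epsilon> \<and> \<epsilon> / Q < e (Suc i) - e i" by auto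
    \<comment> \<open>A difference this small can be shifted past the \<open>N\<close> digits
      already in use without exceeding \<open>\<epsilon>\<close>.\<close>
    obtain n u v where uv: "u \<in> dsums Q n" "v \<in> dsums Q n" "0 < u - v" "u - v < \<epsilon> / Q ^ N"
      using small[folded Q_def, of "\<epsilon> / Q ^ N"] \<epsilon> Q by auto
    have "Q ^ N * (u - v) \<le> \<epsilon>" using uv(4) Q by (simp add: field_simps)
    then obtain k where k: "N \<le> k" "Q ^ k * (u - v) \<le> \<epsilon>" "\<epsilon> < Q * (Q ^ k * (u - v))"
      using scale_into_interval Q uv(3) by metis
    \<comment> \<open>Earlier points carry the block \<open>v\<close>; the new last point has
      \<open>u\<close> in its place.\<close>
    define e' where "e' i = (if i \<le> m then e i + Q ^ k * v else e m + Q ^ k * u)" for i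
    have "e' i \<in> dsums Q (k + n)" for i
      using e(1)[of i] e(1)[of m] dsums_mono[OF k(1)] uv(1,2)
      by (auto simp: e'_def intro!: dsums_append)
    moreover have "e' (Suc i) - e' i \<le> \<epsilon> \<and> \<epsilon> / Q < e' (Suc i) - e' i" if "i < Suc m" for i
      using that e(2)[of i] k(2,3) Q by (cases "i = m") (auto simp: e'_def field_simps)
    ultimately show ?case by blast
  qed
  obtain m :: nat where m: "q * Q / \<epsilon> \<le> real m" using real_arch_simple by blast
  obtain N e where e: "\<And>i. i \<le> m \<Longrightarrow> e i \<in> dsums Q N"
    "\<And>i. i < m \<Longrightarrow> e (Suc i) - e i \<le> \<epsilon>" "\<And>i. i < m \<Longrightarrow> \<epsilon> / Q < e (Suc i) - e i"
    using chain[of m] by blast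
  have grow: "real i * (\<epsilon> / Q) \<le> e i - e 0" if "i \<le> m" for i
    using that
  proof (induction i)
    case (Suc i)
    with e(3)[of i] show ?case by (simp add: algebra_simps)
  qed simp
  have "q \<le> real m * (\<epsilon> / Q)" using m \<epsilon> Q by (simp add: field_simps)
  then have span: "q \<le> e m - e 0" using grow[of m] by simp
  \<comment> \<open>The two conditions place \<open>\<tau> - e 0\<close> in the range
    \<open>{0..q * dmax Q M}\<close> of the odd part.\<close>
  have "eventually (\<lambda>M. max (2 * e 0 - y) ((y - 2 * e 0) / (q - 1)) \<le> dmax Q M) sequentially"
    using filterlim_dmax[OF Q(1)] unfolding filterlim_at_top by blast
  then obtain M0 where M0: "\<And>M. M0 \<le> M \<Longrightarrow> 2 * e 0 - y \<le> dmax Q M"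
      "\<And>M. M0 \<le> M \<Longrightarrow> (y - 2 * e 0) / (q - 1) \<le> dmax Q M"
    by (auto simp: eventually_sequentially)
  define M where "M = Suc (max M0 N)"
  define D where "D = dmax Q M"
  have D: "2 * e 0 - y \<le> D" "y - 2 * e 0 \<le> (q - 1) * D" "0 \<le> D"
    using M0[of M] q Q dmax_nonneg[of Q M] by (auto simp: M_def D_def field_simps)
  define \<tau> where "\<tau> = (y + dmax q (2 * M)) / 2"
  have \<tau>: "\<tau> = (y + (1 + q) * D) / 2" by (simp add: \<tau>_def D_def dmax_even Q_def)
  have "D \<le> q * D" using D(3) q(1) by (simp add: mult_right_mono[of 1 q D, simplified])
  then have "e 0 \<le> \<tau>" "\<tau> - e 0 \<le> q * D" unfolding \<tau> using D by (auto simp: algebra_simps)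
  then have "0 \<le> (\<tau> - e 0) / q" "(\<tau> - e 0) / q \<le> D" using q by (auto simp: field_simps)
  then obtain x where x: "x \<in> dsums Q M" "x \<le> (\<tau> - e 0) / q" "(\<tau> - e 0) / q \<le> x + 1"
    using dsums_approx[of Q] Q unfolding D_def by blast
  then have x2: "e 0 + q * x \<le> \<tau>" "\<tau> \<le> e 0 + q * x + q" using q by (auto simp: field_simps)
  define i where "i = (GREATEST i. i \<le> m \<and> e i + q * x \<le> \<tau>)"
  have i: "i \<le> m \<and> e i + q * x \<le> \<tau>" unfolding i_def
    by (rule GreatestI_nat[of _ 0 m]) (use x2 in auto)
  have "\<tau> \<le> e i + q * x + \<epsilon>"
  proof (cases "i = m")
    case True
    then show ?thesis using x2(2) span \<epsilon> by simp
  next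
    case False
    have "\<not> (Suc i \<le> m \<and> e (Suc i) + q * x \<le> \<tau>)"
      using Greatest_le_nat[of "\<lambda>i. i \<le> m \<and> e i + q * x \<le> \<tau>" "Suc i" m]
      unfolding i_def[symmetric] by auto
    with False i e(2)[of i] show ?thesis by auto
  qed
  with i have "\<bar>e i + q * x - \<tau>\<bar> \<le> \<epsilon>" by auto
  moreover have "N \<le> M" by (simp add: M_def)
  then have "e i \<in> dsums Q M" using e(1)[of i] i dsums_mono[of N M Q] by blast
  then have "e i + q * x \<in> dsums q (2 * M)" using x(1) unfolding Q_def by (intro dsums_even_odd)
  ultimately show "\<exists>n>0. \<exists>x\<in>dsums q n. \<bar>x - (y + dmax q n) / 2\<bar> \<le> \<epsilon>"
    unfolding \<tau>_def by (intro exI[of _ "2 * M"]) (auto simp: M_def)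
qed

text \<open>Feng's argument: an element with the maximal number of neighbours forces the same
  neighbourhood pattern on all of its scaled copies, and every difference of digit sums
  becomes visible in such a pattern after rescaling.\<close>

lemma finite_differences_if_separated:
  fixes b :: real
  assumes b: "1 < b" "b < 2" and \<eta>: "0 < \<eta>"
    and sep: "\<And>n x y. x \<in> dsums b n \<Longrightarrow> y \<in> dsums b n \<Longrightarrow> x < y \<Longrightarrow> \<eta> \<le> y - x"
  shows "finite {y - x | x y n. x \<in> dsums b n \<and> y \<in> dsums b n \<and> 0 \<le> y - x \<and> y - x \<le> C}"
proof -
  \<comment> \<open>The limit of \<open>dmax b n / b ^ n\<close>. It exceeds \<open>1\<close>
    because \<open>b < 2\<close>, which leaves room for a \<open>d\<close> strictly between
    \<open>1\<close> and \<open>c\<close>.\<close>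
  define c where "c = 1 / (b - 1)"
  have c: "1 < c" using b by (simp add: c_def)
  define nb where "nb n y = {z - y | z. z \<in> dsums b n \<and> \<bar>z - y\<bar> \<le> c}" for n y
  have nb: "finite (nb n y)" "real (card (nb n y)) \<le> 2 * c / \<eta> + 1" if "y \<in> dsums b n" for n y
  proof -
    have "nb n y \<subseteq> {- c..- c + 2 * c}" by (auto simp: nb_def)
    moreover have "\<eta> \<le> v - u" if "u \<in> nb n y" "v \<in> nb n y" "u < v" for u v
      using that sep by (force simp: nb_def)
    ultimately show "finite (nb n y)" "real (card (nb n y)) \<le> 2 * c / \<eta> + 1"
      using separated_card_le[of "nb n y" "- c" "2 * c" \<eta>] \<eta> c by auto
  qed
  obtain n0 y0 where y0: "y0 \<in> dsums b n0"
    and max: "\<And>n y. y \<in> dsums b n \<Longrightarrow> card (nb n y) \<le> card (nb n0 y0)"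
  proof -
    obtain B :: nat where "2 * c / \<eta> + 1 \<le> real B" using real_arch_simple by blast
    then have "card (nb n y) \<le> B" if "y \<in> dsums b n" for n y
      using nb(2)[OF that] by linarith
    then obtain p where "snd p \<in> dsums b (fst p)"
      "\<forall>p'. snd p' \<in> dsums b (fst p') \<longrightarrow> card (nb (fst p') (snd p')) \<le> card (nb (fst p) (snd p))"
      using ex_has_greatest_nat[of "\<lambda>p. snd p \<in> dsums b (fst p)" "(0,0)"
          "\<lambda>p. card (nb (fst p) (snd p))" "Suc B"] zero_in_dsums[of b 0]
      by (auto simp: less_Suc_eq_le)
    then show ?thesis using that[of "snd p" "fst p"] by (metis fst_conv snd_conv)
  qed
  have pattern: "\<exists>zs\<in>dsums b n0. z = zs + b ^ n0 * y"
    if y: "y \<in> dsums b k" and z: "z \<in> dsums b (n0 + k)" "\<bar>z - (y0 + b ^ n0 * y)\<bar> \<le> c" for y z k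
  proof -
    have y': "y0 + b ^ n0 * y \<in> dsums b (n0 + k)" using dsums_append y0 y by blast
    have sub: "nb n0 y0 \<subseteq> nb (n0 + k) (y0 + b ^ n0 * y)"
    proof
      fix w assume "w \<in> nb n0 y0"
      then obtain v where "v \<in> dsums b n0" "w = v - y0" "\<bar>v - y0\<bar> \<le> c" by (auto simp: nb_def)
      then show "w \<in> nb (n0 + k) (y0 + b ^ n0 * y)"
        using dsums_append[OF _ y, of v n0] unfolding nb_def
        by (intro CollectI exI[of _ "v + b ^ n0 * y"]) auto
    qed
    have "nb n0 y0 = nb (n0 + k) (y0 + b ^ n0 * y)"
      using card_seteq[OF nb(1)[OF y'] sub] max[OF y'] by simp
    moreover have "z - (y0 + b ^ n0 * y) \<in> nb (n0 + k) (y0 + b ^ n0 * y)"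
      using z by (auto simp: nb_def)
    ultimately have "z - (y0 + b ^ n0 * y) \<in> nb n0 y0" by simp
    then obtain v where "v \<in> dsums b n0" "z - (y0 + b ^ n0 * y) = v - y0"
      unfolding nb_def by blast
    then show ?thesis by (intro bexI[of _ v]) auto
  qed
  define Diff where
    "Diff C = {y - x | x y n. x \<in> dsums b n \<and> y \<in> dsums b n \<and> 0 \<le> y - x \<and> y - x \<le> C}" for C
  have small: "finite (Diff d)" if "d < c" for d
  proof -
    \<comment> \<open>Since \<open>dmax b J\<close> grows like \<open>c * b ^ J\<close> and
      \<open>d < c\<close>, a large \<open>J\<close> makes every target \<open>s\<close> below
      representable with \<open>J\<close> digits.\<close>
    obtain j where j: "(c + dmax b n0) / (c - d) < b ^ j" using real_arch_pow b(1) by blast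
    define J where "J = n0 + j"
    have "b ^ j \<le> b ^ J" using b by (simp add: J_def power_increasing)
    then have "b ^ j * (c - d) \<le> b ^ J * (c - d)" using that by (intro mult_right_mono) auto
    moreover have "c + dmax b n0 < b ^ j * (c - d)" using j that by (simp add: pos_divide_less_eq)
    ultimately have "c + dmax b n0 \<le> b ^ J * (c - d)" by linarith
    moreover have "dmax b J = c * b ^ J - c" using b by (simp add: dmax_eq c_def diff_divide_distrib)
    ultimately have J: "b ^ J * d + dmax b n0 \<le> dmax b J" by (simp add: algebra_simps)
    have "Diff d \<subseteq> (\<lambda>(u, v). (u - v) / b ^ J) ` (dsums b J \<times> dsums b n0)"
    proof
      fix w assume "w \<in> Diff d"
      then obtain x y k where w: "x \<in> dsums b k" "y \<in> dsums b k" "0 \<le> y - x" "y - x \<le> d" "w = y - x"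
        by (auto simp: Diff_def)
      \<comment> \<open>With \<open>u\<close> close to \<open>s\<close>, the point
        \<open>u + b ^ J * x\<close> is a neighbour of the copy of \<open>y0\<close> at
        \<open>b ^ J * y\<close>. The pattern then expresses \<open>y - x\<close> through
        \<open>u\<close> and some \<open>v\<close> from fixed finite sets.\<close>
      define s where "s = b ^ J * (y - x) + y0"
      have "0 \<le> s" using w(3) b dsums_bounds(1)[OF _ y0] by (simp add: s_def)
      moreover have "s \<le> b ^ J * d + dmax b n0" unfolding s_def
        using w(4) b dsums_bounds(2)[OF _ y0] by (intro add_mono mult_left_mono) auto
      ultimately obtain u where u: "u \<in> dsums b J" "u \<le> s" "s \<le> u + 1"
        using dsums_approx[of b s J] b J by auto
      have "0 + b ^ j * y \<in> dsums b (j + k)" using dsums_append zero_in_dsums w(2) by blast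
      moreover have "u + b ^ J * x \<in> dsums b (n0 + (j + k))"
        using dsums_append[OF u(1) w(1)] by (simp add: J_def add.assoc)
      moreover have "\<bar>u + b ^ J * x - (y0 + b ^ n0 * (0 + b ^ j * y))\<bar> \<le> c"
        using u(2,3) c by (simp add: s_def J_def power_add algebra_simps)
      ultimately obtain v where v: "v \<in> dsums b n0" "u + b ^ J * x = v + b ^ n0 * (0 + b ^ j * y)"
        using pattern by blast
      then have "w = (u - v) / b ^ J" using b by (simp add: w(5) J_def power_add field_simps)
      then show "w \<in> (\<lambda>(u, v). (u - v) / b ^ J) ` (dsums b J \<times> dsums b n0)"
        using u(1) v(1) by auto
    qed
    then show ?thesis by (rule finite_subset) (simp add: finite_dsums)
  qed
  \<comment> \<open>Because \<open>d > 1\<close>, an element within \<open>1\<close> below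
    \<open>x + d\<close> lies strictly above \<open>x\<close>, hence at least \<open>\<eta>\<close>
    above it. Each such step shortens a long difference by \<open>\<eta>\<close>.\<close>
  define d where "d = (1 + c) / 2"
  have d: "1 < d" "d < c" using c by (auto simp: d_def)
  have all: "finite (Diff (d + real m * \<eta>))" for m
  proof (induction m)
    case 0
    show ?case using small[OF d(2)] by simp
  next
    case (Suc m)
    have "Diff (d + real (Suc m) * \<eta>) \<subseteq>
        Diff d \<union> (\<lambda>(u, v). u + v) ` (Diff d \<times> Diff (d + real m * \<eta>))"
    proof
      fix w assume "w \<in> Diff (d + real (Suc m) * \<eta>)"
      then obtain x y k where w: "x \<in> dsums b k" "y \<in> dsums b k" "0 \<le> y - x"
        "y - x \<le> d + real (Suc m) * \<eta>" "w = y - x"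
        by (auto simp: Diff_def)
      show "w \<in> Diff d \<union> (\<lambda>(u, v). u + v) ` (Diff d \<times> Diff (d + real m * \<eta>))"
      proof (cases "y - x \<le> d")
        case True
        then show ?thesis using w by (auto simp: Diff_def)
      next
        case False
        have "0 \<le> x + d" "x + d \<le> dmax b k"
          using False d dsums_bounds(1)[OF _ w(1)] dsums_bounds(2)[OF _ w(2)] b by auto
        then obtain z where z: "z \<in> dsums b k" "z \<le> x + d" "x + d \<le> z + 1"
          using dsums_approx[of b "x + d" k] b by auto
        then have "\<eta> \<le> z - x" using sep[of x k z] w(1) d by auto
        then have "z - x \<in> Diff d" "y - z \<in> Diff (d + real m * \<eta>)"
          unfolding Diff_def using z w False \<eta> by (force simp: algebra_simps)+
        then show ?thesis using w(5) by (intro UnI2 image_eqI[of _ _ "(z - x, y - z)"]) auto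
      qed
    qed
    then show ?case using small[OF d(2)] Suc by (meson finite_SigmaI finite_UnI finite_imageI finite_subset)
  qed
  obtain m :: nat where "C / \<eta> \<le> real m" using real_arch_simple by blast
  then have "C \<le> d + real m * \<eta>" using \<eta> d by (simp add: field_simps)
  then have "Diff C \<subseteq> Diff (d + real m * \<eta>)" unfolding Diff_def by force
  then show ?thesis using all finite_subset unfolding Diff_def by blast
qed

section \<open>Bases whose spectrum is locally finite\<close>

text \<open>The values \<open>ieval F b\<close> for \<open>F\<close> in \<open>height1\<close> form
  the spectrum of the base \<open>b\<close>; the number of digits is left open.\<close>

definition height1 :: "int poly set" where
  "height1 = {F. \<forall>i. coeff F i \<in> {-1,0,1}}"

lemma height1_pCons [simp]: "pCons a F \<in> height1 \<longleftrightarrow> a \<in> {-1,0,1} \<and> F \<in> height1"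
  unfolding height1_def by (auto simp: coeff_pCons split: nat.splits)

lemma height1_minus: "F \<in> height1 \<Longrightarrow> - F \<in> height1"
  by (auto simp: height1_def)

lemma one_in_height1: "1 \<in> height1"
  by (simp add: one_pCons) (simp add: height1_def)

lemma height1_digit_polys: "F \<in> height1 \<Longrightarrow> F \<in> digit_polys {-1,0,1} (Suc (degree F))"
  by (auto simp: height1_def digit_polys_def coeff_eq_0)

section \<open>Infinite expansions with prescribed digit signs\<close>

definition bexp :: "real \<Rightarrow> (nat \<Rightarrow> bool) \<Rightarrow> real" where
  "bexp b e = (\<Sum>i. of_bool (e i) / b ^ Suc i)"

lemma geometric_Suc_sums:
  fixes b :: real
  assumes "1 < b"
  shows "(\<lambda>i. 1 / b ^ Suc i) sums (1 / (b - 1))"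
proof -
  have "(\<lambda>i. (1 / b) * (1 / b) ^ i) sums ((1 / b) * (1 / (1 - 1 / b)))"
    using assms by (intro sums_mult geometric_sums) auto
  then show ?thesis using assms by (simp add: field_simps)
qed

lemma bexp_summable:
  assumes "1 < b"
  shows "summable (\<lambda>i. of_bool (e i) / b ^ Suc i :: real)"
  by (rule summable_comparison_test'[OF sums_summable[OF geometric_Suc_sums[OF assms]], of 0])
    (use assms in \<open>auto simp: field_simps\<close>)

lemma bexp_Suc:
  assumes "1 < b"
  shows "b * bexp b e = of_bool (e 0) + bexp b (\<lambda>i. e (Suc i))"
proof -
  have "bexp b e = of_bool (e 0) / b + (\<Sum>i. of_bool (e (Suc i)) / b ^ Suc (Suc i))"
    unfolding bexp_def using suminf_split_head[OF bexp_summable[OF assms, of e]] by simp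
  also have "(\<Sum>i. of_bool (e (Suc i)) / b ^ Suc (Suc i)) = bexp b (\<lambda>i. e (Suc i)) / b"
    unfolding bexp_def using suminf_divide[OF bexp_summable[OF assms], of "\<lambda>i. e (Suc i)" b]
    by (simp add: mult_ac)
  finally show ?thesis using assms by (simp add: field_simps)
qed

lemma bexp_not:
  assumes "1 < b"
  shows "bexp b (\<lambda>i. \<not> e i) = 1 / (b - 1) - bexp b e"
proof -
  have "bexp b (\<lambda>i. \<not> e i) + bexp b e = (\<Sum>i. 1 / b ^ Suc i)"
    unfolding bexp_def
    by (subst suminf_add[OF bexp_summable[OF assms] bexp_summable[OF assms]])
      (intro suminf_cong, auto)
  also have "\<dots> = 1 / (b - 1)" using geometric_Suc_sums[OF assms] by (rule sums_unique[symmetric])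
  finally show ?thesis by simp
qed

lemma bexp_nonneg: "1 < b \<Longrightarrow> 0 \<le> bexp b e"
  unfolding bexp_def by (intro suminf_nonneg bexp_summable) auto

lemma bexp_le: "1 < b \<Longrightarrow> bexp b e \<le> 1 / (b - 1)"
  using bexp_not[of b e] bexp_nonneg[of b "\<lambda>i. \<not> e i"] by linarith

lemma bexp_True: "1 < b \<Longrightarrow> bexp b (\<lambda>_. True) = 1 / (b - 1)"
  using bexp_not[of b "\<lambda>_. False"] by (simp add: bexp_def)

text \<open>\<open>F n\<close> is the remainder after \<open>n\<close> digits. The remaining
  positions can at most contribute \<open>S n\<close> (digit \<open>1\<close> wherever
  \<open>e\<close> holds) and at least \<open>S n - c\<close> (digit \<open>-1\<close> elsewhere);
  the greedy choice keeps the remainder between these extremes.\<close>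

lemma sign_coherent_expansion:
  fixes b :: real
  assumes b: "1 < b" "b \<le> 2" and F0: "F0 \<in> height1"
    and y: "bexp b e - 1 / (b - 1) \<le> ieval F0 b" "ieval F0 b \<le> bexp b e"
  obtains F t where "F 0 = F0" "\<And>n. F (Suc n) = pCons (- t n) (F n)"
    "\<And>n. t n \<in> (if e n then {0,1} else {-1,0})"
    "\<And>n. F n \<in> height1" "\<And>n. \<bar>ieval (F n) b\<bar> \<le> 1 / (b - 1)"
proof -
  define c where "c = 1 / (b - 1)"
  have c: "1 \<le> c" using b by (simp add: c_def)
  define S where "S n = bexp b (\<lambda>i. e (i + n))" for n
  have S: "b * S n = of_bool (e n) + S (Suc n)" "0 \<le> S n" "S n \<le> c" for n
    using bexp_Suc[OF b(1), of "\<lambda>i. e (i + n)"] bexp_nonneg[OF b(1)] bexp_le[OF b(1)]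
    by (simp_all add: S_def c_def)
  \<comment> \<open>A digit is spent only when the remainder would otherwise leave its interval.
    That interval has length \<open>c \<ge> 1\<close>, so the correction by \<open>1\<close> does
    not overshoot.\<close>
  define T :: "nat \<Rightarrow> real \<Rightarrow> int" where
    "T n v = (if e n then if b * v > S (Suc n) then 1 else 0
              else if b * v < S (Suc n) - c then -1 else 0)" for n v
  define F where "F = rec_nat F0 (\<lambda>n G. pCons (- T n (ieval G b)) G)"
  define t where "t n = T n (ieval (F n) b)" for n
  have F: "F 0 = F0" "\<And>n. F (Suc n) = pCons (- t n) (F n)"
    by (simp_all add: F_def t_def)
  have t: "t n \<in> (if e n then {0,1} else {-1,0})" for n
    by (auto simp: t_def T_def)
  have bc: "b * c = c + 1" using b by (simp add: c_def field_simps)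
  have inv: "S n - c \<le> ieval (F n) b \<and> ieval (F n) b \<le> S n" for n
  proof (induction n)
    case 0
    then show ?case using y by (simp add: F S_def c_def)
  next
    case (Suc n)
    define v where "v = ieval (F n) b"
    have "b * (S n - c) \<le> b * v" "b * v \<le> b * S n"
      using Suc b by (auto simp: v_def intro!: mult_left_mono)
    then have v: "of_bool (e n) + S (Suc n) - c - 1 \<le> b * v" "b * v \<le> of_bool (e n) + S (Suc n)"
      using S(1)[of n] bc by (simp_all add: algebra_simps)
    have "ieval (F (Suc n)) b = b * v - of_int (T n v)"
      by (simp add: F t_def v_def)
    then show ?case using v c by (auto simp: T_def split: if_splits)
  qed
  have h: "F n \<in> height1" for n
  proof (induction n)
    case (Suc n)
    then show ?case using t[of n] by (auto simp: F split: if_splits)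
  qed (simp add: F F0)
  have bd: "\<bar>ieval (F n) b\<bar> \<le> 1 / (b - 1)" for n
    using inv[of n] S(2,3)[of n] by (simp add: c_def[symmetric] abs_le_iff)
  show ?thesis by (rule that[OF F t h bd])
qed

section \<open>A base with locally finite spectrum is a Pisot number\<close>

locale finite_spectrum =
  fixes b :: real
  assumes b: "1 < b" "b < 2"
    and finite_spectrum: "\<And>C. finite ((\<lambda>F. ieval F b) ` {F \<in> height1. \<bar>ieval F b\<bar> \<le> C})"
begin

definition "c = 1 / (b - 1)"

lemma c: "1 < c" "b * c = c + 1"
  using b by (auto simp: c_def field_simps)

text \<open>By conjugacy the value at \<open>P\<close> depends only on the value at
  \<open>b\<close>, and the latter takes finitely many values.\<close>

lemma conj_bounded:
  assumes "alg_conj (of_real b) P"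
  obtains M where "\<And>F. F \<in> height1 \<Longrightarrow> \<bar>ieval F b\<bar> \<le> c \<Longrightarrow> norm (ieval F P) \<le> M"
proof -
  define V where "V = (\<lambda>F. ieval F b) ` {F \<in> height1. \<bar>ieval F b\<bar> \<le> c}"
  define g where "g v = ieval (SOME F. ieval F b = v) P" for v
  have "finite (g ` V)" unfolding V_def by (intro finite_imageI finite_spectrum)
  then obtain M where M: "\<forall>w\<in>g ` V. norm w \<le> M"
    using finite_imp_bounded bounded_iff by blast
  show ?thesis
  proof (rule that)
    fix F assume F: "F \<in> height1" "\<bar>ieval F b\<bar> \<le> c"
    define G where "G = (SOME G. ieval G b = ieval F b)"
    have "ieval G b = ieval F b"
      unfolding G_def by (rule someI[of _ F]) (rule refl)
    then have "ieval G (of_real b :: complex) = ieval F (of_real b)" by simp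
    then have "ieval G P = ieval F P" using alg_conj_eq_iff[OF assms] by blast
    then have "ieval F P = g (ieval F b)" unfolding g_def G_def by (rule sym)
    then have "ieval F P \<in> g ` V" using F by (simp add: V_def)
    then show "norm (ieval F P) \<le> M" using M by blast
  qed
qed

lemma not_root_of_unity:
  assumes "alg_conj (of_real b) P" "0 < j"
  shows "P ^ j \<noteq> 1"
proof
  assume "P ^ j = 1"
  then have "ieval (monom 1 j - 1) P = 0" by simp
  then have "ieval (monom 1 j - 1) (of_real b :: complex) = 0"
    using assms(1) by (simp only: alg_conj_def)
  then have "(of_real (b ^ j) :: complex) = of_real 1" by simp
  then have "b ^ j = 1" unfolding of_real_eq_iff .
  then show False using b assms(2) by (metis less_irrefl one_less_power)
qed

text \<open>Expand \<open>ieval F0 b\<close> with digits whose signs follow \<open>Re (\<theta> / P ^ Suc i)\<close>. At the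
  conjugate \<open>P\<close> every nonzero digit then pushes the remainder in the same direction, whereas
  the remainders take only finitely many values. For \<open>norm P = 1\<close> the pushes could become
  small only if some power of \<open>P\<close> were real, i.e. \<open>P\<close> a root of unity.\<close>

lemma expansion_le:
  assumes P: "alg_conj (of_real b) P" "1 \<le> norm P"
    and F0: "F0 \<in> height1" "0 < ieval F0 b"
    and \<theta>: "Re (\<theta> * ieval F0 P) < 0"
    and e: "\<And>i. 0 < Re (\<theta> / P ^ Suc i) \<Longrightarrow> e i" "\<And>i. Re (\<theta> / P ^ Suc i) < 0 \<Longrightarrow> \<not> e i"
  shows "bexp b e < ieval F0 b"
proof (rule ccontr)
  assume "\<not> bexp b e < ieval F0 b"
  then have "bexp b e - 1 / (b - 1) \<le> ieval F0 b" "ieval F0 b \<le> bexp b e"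
    using F0(2) bexp_le[OF b(1), of e] by auto
  then obtain F t where F: "F 0 = F0" "\<And>n. F (Suc n) = pCons (- t n) (F n)"
    and t: "\<And>n. t n \<in> (if e n then {0,1} else {-1,0})"
    and h: "\<And>n. F n \<in> height1" "\<And>n. \<bar>ieval (F n) b\<bar> \<le> c"
    using sign_coherent_expansion[OF b(1) less_imp_le[OF b(2)] F0(1)] unfolding c_def by metis
  have P0: "P \<noteq> 0" using P(2) by auto
  obtain M where M: "\<And>n. norm (ieval (F n) P) \<le> M"
    using conj_bounded[OF P(1)] h by metis
  define \<rho> where "\<rho> n = Re (\<theta> / P ^ Suc n)" for n
  \<comment> \<open>The component of the remainder at \<open>P\<close> in the direction
    \<open>\<theta> / P ^ n\<close>; the sign rule for the digits makes it decrease by the size of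
    each contribution.\<close>
  define g where "g n = Re (\<theta> / P ^ n * ieval (F n) P)" for n
  have t\<rho>: "of_int (t n) * \<rho> n = \<bar>of_int (t n) * \<rho> n\<bar>" for n
    using t[of n] e(1,2)[of n] unfolding \<rho>_def[symmetric]
    by (cases "\<rho> n > 0"; cases "\<rho> n < 0") (auto simp: split: if_splits)
  have step: "g (Suc n) = g n - \<bar>of_int (t n) * \<rho> n\<bar>" for n
  proof -
    have "\<theta> / P ^ Suc n * ieval (F (Suc n)) P =
        \<theta> / P ^ n * ieval (F n) P - of_int (t n) * (\<theta> / P ^ Suc n)"
      using P0 by (simp add: F field_simps)
    then have "g (Suc n) = g n - Re (of_int (t n) * (\<theta> / P ^ Suc n))"
      by (simp only: g_def minus_complex.sel)
    moreover have "Re (of_int (t n) * w) = of_int (t n) * Re w" for w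
      by simp
    ultimately show ?thesis using t\<rho>[of n] unfolding \<rho>_def by presburger
  qed
  have g_mono: "g (n + k) \<le> g n" for n k
  proof (induction k)
    case (Suc k)
    then show ?case using step[of "n + k"] by simp
  qed simp
  have g0: "g 0 < 0" using \<theta> by (simp add: g_def F)
  then have g_neg: "g n \<le> g 0" for n using g_mono[of 0 n] by simp
  have g_bound: "\<bar>g n\<bar> \<le> norm \<theta> / norm P ^ n * M" for n
  proof -
    have "\<bar>g n\<bar> \<le> norm (\<theta> / P ^ n) * norm (ieval (F n) P)"
      unfolding g_def using abs_Re_le_cmod[of "\<theta> / P ^ n * ieval (F n) P"] by (simp only: norm_mult)
    also have "\<dots> \<le> norm (\<theta> / P ^ n) * M" by (intro mult_left_mono M) auto
    finally show ?thesis by (simp add: norm_divide norm_power)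
  qed
  show False
  \<comment> \<open>Outside the closed unit disc \<open>g_bound\<close> forces \<open>g\<close> to
    \<open>0\<close>, although it stays below \<open>g 0 < 0\<close>. On the circle \<open>g\<close>
    is bounded, so its total decrease has to be shown unbounded.\<close>
  proof (cases "norm P = 1")
    case False
    then have "1 < norm P" using P(2) by simp
    then have "(\<lambda>n. norm \<theta> / norm P ^ n * M) \<longlonglongrightarrow> 0"
      by (intro tendsto_mult_left_zero LIMSEQ_divide_realpow_zero)
    from order_tendstoD(2)[OF this, of "- g 0"]
    have "eventually (\<lambda>n. norm \<theta> / norm P ^ n * M < - g 0) sequentially"
      using g0 by simp
    then obtain n where "norm \<theta> / norm P ^ n * M < - g 0"
      by (auto simp: eventually_sequentially)
    then show False using g_bound[of n] g_neg[of n] by linarith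
  next
    case True
    have v0: "ieval (F n) b \<noteq> 0" for n
    proof
      assume "ieval (F n) b = 0"
      then have "ieval (F n) P = 0" using P(1) by (metis alg_conj_def ieval_of_real of_real_0)
      then show False using g_neg[of n] g0 by (simp add: g_def)
    qed
    define V where "V = (\<lambda>F. ieval F b) ` {F \<in> height1. \<bar>ieval F b\<bar> \<le> c} - {0}"
    have "finite V" unfolding V_def by (intro finite_Diff finite_spectrum)
    then obtain l where l: "0 < l" "\<And>v. v \<in> V \<Longrightarrow> l \<le> \<bar>v\<bar>"
    proof -
      have "\<exists>l>0. \<forall>v\<in>V. l \<le> \<bar>v\<bar>"
        using finite_set_avoid[OF \<open>finite V\<close>, of 0] by (auto simp: V_def dist_real_def)
      then show ?thesis using that by blast
    qed
    have vl: "l \<le> \<bar>ieval (F n) b\<bar>" for n using l(2) h v0 by (auto simp: V_def)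
    \<comment> \<open>The remainders are nonzero and at least \<open>l\<close> in size; after
      \<open>K\<close> zero digits in a row they would exceed \<open>c\<close>.\<close>
    obtain K where K: "c / l < b ^ K" using real_arch_pow b(1) by blast
    have nonzero: "\<exists>j<K. t (n + j) \<noteq> 0" for n
    proof (rule ccontr)
      assume "\<not> (\<exists>j<K. t (n + j) \<noteq> 0)"
      then have z: "t (n + j) = 0" if "j < K" for j using that by blast
      have "ieval (F (n + j)) b = b ^ j * ieval (F n) b" if "j \<le> K" for j
        using that
      proof (induction j)
        case (Suc j)
        then show ?case using z[of j] by (simp add: F)
      qed simp
      then have "\<bar>ieval (F (n + K)) b\<bar> = b ^ K * \<bar>ieval (F n) b\<bar>" using b by (simp add: abs_mult)
      moreover have "c < b ^ K * l" using K l by (simp add: pos_divide_less_eq)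
      moreover have "b ^ K * l \<le> b ^ K * \<bar>ieval (F n) b\<bar>" using vl b by (intro mult_left_mono) auto
      ultimately show False using h(2)[of "n + K"] by linarith
    qed
    define J where "J = {1..2 * K}"
    obtain \<kappa> where \<kappa>: "0 < \<kappa>" "\<And>j. 0 < j \<Longrightarrow> j \<le> 2 * K \<Longrightarrow> \<kappa> \<le> \<bar>Im (P ^ j)\<bar>"
    proof -
      have im: "Im (P ^ j) \<noteq> 0" if "0 < j" for j
      proof
        assume im0: "Im (P ^ j) = 0"
        then have "P ^ j \<in> \<real>" by (simp only: complex_is_Real_iff)
        then obtain r where r: "P ^ j = of_real r" by (elim Reals_cases)
        have "norm (P ^ j) = 1" using True by (simp add: norm_power)
        then have "\<bar>r\<bar> = 1" unfolding r by simp
        then have "r\<^sup>2 = 1" by (metis one_power2 power2_abs)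
        then have "(P ^ j)\<^sup>2 = 1" unfolding r by (metis of_real_1 of_real_power)
        then have "P ^ (j * 2) = 1" by (simp only: power_mult)
        then show False using not_root_of_unity[OF P(1), of "j * 2"] that by simp
      qed
      have "finite ((\<lambda>j. Im (P ^ j)) ` J)" by (simp add: J_def)
      from finite_set_avoid[OF this, of 0] obtain d where
        d: "0 < d" "\<And>x. x \<in> (\<lambda>j. Im (P ^ j)) ` J \<Longrightarrow> x \<noteq> 0 \<Longrightarrow> d \<le> dist 0 x" by blast
      show ?thesis using d im by (intro that[of d]) (auto simp: J_def dist_real_def)
    qed
    have \<theta>0: "\<theta> \<noteq> 0" using \<theta> by auto
    \<comment> \<open>Two nonzero digits fall within \<open>2 * K\<close> places. Their directions
      \<open>z\<close> and \<open>z'\<close> differ by the rotation \<open>P ^ (m' - m)\<close>,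
      which is bounded away from real, so \<open>Re z\<close> and \<open>Re z'\<close> cannot both
      be small.\<close>
    have drop: "g (n + 2 * K) \<le> g n - norm \<theta> * \<kappa>" for n
    proof -
      obtain j where j: "j < K" "t (n + j) \<noteq> 0" using nonzero by blast
      obtain k where k: "k < K" "t (n + K + k) \<noteq> 0" using nonzero by blast
      define m m' where "m = n + j" and "m' = n + K + k"
      have mm: "m < m'" "m' - m \<le> 2 * K" "m' < n + 2 * K" using j k by (auto simp: m_def m'_def)
      define z z' where "z = \<theta> / P ^ Suc m" and "z' = \<theta> / P ^ Suc m'"
      have nz: "norm z = norm \<theta>" "norm z' = norm \<theta>"
        using True by (simp_all add: z_def z'_def norm_divide norm_power norm_mult)
      have "P ^ Suc m' = P ^ Suc m * P ^ (m' - m)" using mm by (simp flip: power_add)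
      then have zz: "z = z' * P ^ (m' - m)" using P0 by (simp add: z_def z'_def field_simps)
      have "z * cnj z' = of_real ((norm \<theta>)\<^sup>2) * P ^ (m' - m)"
        using complex_norm_square[of z'] nz(2) by (simp add: zz mult_ac)
      moreover have "Im (of_real r * w) = r * Im w" for r w by simp
      ultimately have "Im (z * cnj z') = (norm \<theta>)\<^sup>2 * Im (P ^ (m' - m))" by presburger
      then have "\<bar>Im (z * cnj z')\<bar> = (norm \<theta>)\<^sup>2 * \<bar>Im (P ^ (m' - m))\<bar>" by (simp add: abs_mult)
      moreover have "(norm \<theta>)\<^sup>2 * \<kappa> \<le> (norm \<theta>)\<^sup>2 * \<bar>Im (P ^ (m' - m))\<bar>"
        using \<kappa>(2)[of "m' - m"] mm by (intro mult_left_mono) auto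
      moreover have "\<bar>Im (z * cnj z')\<bar> \<le> norm \<theta> * (\<bar>Re z\<bar> + \<bar>Re z'\<bar>)"
      proof -
        have "\<bar>Im (z * cnj z')\<bar> = \<bar>Im z * Re z' - Re z * Im z'\<bar>" by (simp add: mult_ac)
        also have "\<dots> \<le> \<bar>Im z\<bar> * \<bar>Re z'\<bar> + \<bar>Re z\<bar> * \<bar>Im z'\<bar>"
          by (metis abs_mult abs_triangle_ineq4)
        also have "\<dots> \<le> norm \<theta> * \<bar>Re z'\<bar> + \<bar>Re z\<bar> * norm \<theta>"
          using abs_Im_le_cmod[of z] abs_Im_le_cmod[of z'] nz
          by (intro add_mono mult_right_mono mult_left_mono) auto
        finally show ?thesis by (simp add: algebra_simps)
      qed
      ultimately have "norm \<theta> * (norm \<theta> * \<kappa>) \<le> norm \<theta> * (\<bar>Re z\<bar> + \<bar>Re z'\<bar>)"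
        by (simp add: power2_eq_square)
      then have "norm \<theta> * \<kappa> \<le> \<bar>\<rho> m\<bar> + \<bar>\<rho> m'\<bar>" using \<theta>0 by (simp add: \<rho>_def z_def z'_def)
      moreover have "\<bar>of_int (t i) * \<rho> i\<bar> \<ge> \<bar>\<rho> i\<bar>" if "t i \<noteq> 0" for i
        using t[of i] that by (auto simp: abs_mult split: if_splits)
      then have "\<bar>\<rho> m\<bar> \<le> g m - g (Suc m)" "\<bar>\<rho> m'\<bar> \<le> g m' - g (Suc m')"
        using step[of m] step[of m'] j k by (auto simp: m_def m'_def)
      moreover have "g m \<le> g n" "g m' \<le> g (Suc m)" "g (n + 2 * K) \<le> g (Suc m')"
        using g_mono[of n j] g_mono[of "Suc m" "m' - Suc m"] g_mono[of "Suc m'" "n + 2 * K - Suc m'"] mm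
        by (simp_all add: m_def)
      ultimately show ?thesis by linarith
    qed
    have dropn: "g (2 * K * i) \<le> g 0 - real i * (norm \<theta> * \<kappa>)" for i
    proof (induction i)
      case (Suc i)
      then show ?case using drop[of "2 * K * i"] by (simp add: algebra_simps)
    qed simp
    have pos: "0 < norm \<theta> * \<kappa>" using \<theta>0 \<kappa> by simp
    obtain i :: nat where "norm \<theta> * M / (norm \<theta> * \<kappa>) \<le> real i" using real_arch_simple by blast
    then have "norm \<theta> * M \<le> real i * (norm \<theta> * \<kappa>)" using pos by (simp only: pos_divide_le_eq)
    moreover have "\<bar>g (2 * K * i)\<bar> \<le> norm \<theta> * M" using g_bound[of "2 * K * i"] unfolding True by simp
    ultimately show False using dropn[of i] g0 by linarith
  qed
qed

end

text \<open>The remainder is \<open>x ^ n\<close> times the error of the partial sum, so bounded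
  remainders force convergence to \<open>1\<close>.\<close>

lemma bounded_expansion_sums:
  fixes x :: real and t :: "nat \<Rightarrow> int"
  assumes x: "1 < x" and F: "F 0 = 1" "\<And>n. F (Suc n) = pCons (- t n) (F n)"
    and M: "\<And>n. \<bar>ieval (F n) x\<bar> \<le> M"
  shows "(\<lambda>i. of_int (t i) / x ^ Suc i) sums 1"
proof -
  have eq: "ieval (F n) x = x ^ n * (1 - (\<Sum>i<n. of_int (t i) / x ^ Suc i))" for n
  proof (induction n)
    case (Suc n)
    have "x ^ Suc n * (1 - (\<Sum>i<Suc n. of_int (t i) / x ^ Suc i)) =
        x * (x ^ n * (1 - (\<Sum>i<n. of_int (t i) / x ^ Suc i))) - of_int (t n)"
      using x by (simp add: field_simps)
    with Suc show ?case by (simp add: F)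
  qed (simp add: F)
  have "(\<lambda>n. ieval (F n) x / x ^ n) \<longlonglongrightarrow> 0"
  proof (rule Lim_null_comparison)
    show "eventually (\<lambda>n. norm (ieval (F n) x / x ^ n) \<le> M / x ^ n) sequentially"
      using M x by (intro always_eventually) (auto simp: abs_divide intro!: divide_right_mono)
    show "(\<lambda>n. M / x ^ n) \<longlonglongrightarrow> 0" by (rule LIMSEQ_divide_realpow_zero[OF x])
  qed
  then have "(\<lambda>n. 1 - ieval (F n) x / x ^ n) \<longlonglongrightarrow> 1 - 0"
    by (intro tendsto_diff tendsto_const)
  moreover have "1 - ieval (F n) x / x ^ n = (\<Sum>i<n. of_int (t i) / x ^ Suc i)" for n
    using x by (simp add: eq)
  ultimately show ?thesis unfolding sums_def by simp
qed

text \<open>A larger base makes every term with nonzero digit strictly smaller, so equal sums leave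
  only zero digits.\<close>

lemma sums_base_unique:
  fixes x y :: real and t :: "nat \<Rightarrow> int"
  assumes "1 < x" "x < y" "\<And>i. t i \<in> {0,1}"
    and sx: "(\<lambda>i. of_int (t i) / x ^ Suc i) sums 1" and sy: "(\<lambda>i. of_int (t i) / y ^ Suc i) sums 1"
  shows False
proof -
  have "(\<lambda>i. of_int (t i) / x ^ Suc i - of_int (t i) / y ^ Suc i) sums (1 - 1)"
    by (rule sums_diff[OF sx sy])
  moreover have nn: "0 \<le> of_int (t i) / x ^ Suc i - of_int (t i) / y ^ Suc i" for i
  proof -
    have "x ^ Suc i \<le> y ^ Suc i" using assms(1,2) by (intro power_mono) auto
    then show ?thesis using assms(1) assms(3)[of i] by (auto simp: frac_le)
  qed
  ultimately have "of_int (t i) / x ^ Suc i - of_int (t i) / y ^ Suc i = 0" for i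
    using suminf_eq_zero_iff[OF sums_summable nn] sums_unique by fastforce
  moreover have "x ^ Suc i < y ^ Suc i" for i using assms(1,2) by (intro power_strict_mono) auto
  ultimately have "t i = 0" for i
    using assms(1,2) assms(3)[of i] by (smt (verit) insert_iff singletonD of_int_1 frac_less2 zero_less_power)
  then have "(\<lambda>i. of_int (t i) / x ^ Suc i) sums 0" by simp
  with sx show False using sums_unique2 by fastforce
qed

context finite_spectrum
begin

text \<open>A direction that \<open>P\<close> turns from the right half-plane (relative to \<open>ieval F P\<close>) to the left
  one gives two incompatible bounds on the same digit string.\<close>

lemma no_small_element:
  assumes P: "alg_conj (of_real b) P" "1 \<le> norm P" and nonreal: "\<And>r. 0 \<le> r \<Longrightarrow> P \<noteq> of_real r"
    and F: "F \<in> height1" "0 < ieval F b"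
  shows "c / (b + 1) < ieval F b"
proof -
  define w where "w = ieval F P"
  have w: "w \<noteq> 0"
  proof
    assume "w = 0"
    then have "ieval F (of_real b :: complex) = 0" using P(1) unfolding alg_conj_def w_def by blast
    then show False using F(2) by simp
  qed
  obtain \<zeta> where \<zeta>: "0 < Re \<zeta>" "Re (\<zeta> * P) < 0"
  proof (cases "Im P = 0")
    case True
    then have "P = of_real (Re P)" by (simp add: complex_eq_iff)
    then have "Re P < 0" using nonreal[of "Re P"] by (meson not_less)
    then show ?thesis by (intro that[of 1]) auto
  next
    case False
    \<comment> \<open>The imaginary part is chosen so that
      \<open>Re (\<zeta> * P) = -1\<close>.\<close>
    then show ?thesis by (intro that[of "Complex 1 ((Re P + 1) / Im P)"]) auto
  qed
  define \<theta> where "\<theta> = \<zeta> / w"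
  define e where "e i = (0 < Re (\<theta> / P ^ Suc i))" for i
  have "bexp b (\<lambda>i. \<not> e i) < ieval F b"
  proof (rule expansion_le[OF P F, of "- \<theta>"])
    show "Re (- \<theta> * ieval F P) < 0" using \<zeta>(1) w by (simp add: \<theta>_def w_def[symmetric])
    have m: "- \<theta> / P ^ Suc i = - (\<theta> / P ^ Suc i)" for i by simp
    show "\<not> e i" if "0 < Re (- \<theta> / P ^ Suc i)" for i
      using that unfolding m e_def uminus_complex.sel by linarith
    show "\<not> \<not> e i" if "Re (- \<theta> / P ^ Suc i) < 0" for i
      using that unfolding m e_def uminus_complex.sel by linarith
  qed
  then have 1: "c - bexp b e < ieval F b" using bexp_not[OF b(1)] by (simp add: c_def)
  \<comment> \<open>Multiplying the direction by \<open>P\<close> shifts the digit string by one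
    place. Hence \<open>bexp b e \<le> b * bexp b e'\<close>, and the two bounds add up to
    \<open>c < (b + 1) * ieval F b\<close>.\<close>
  define e' where "e' i = (0 < Re (P * \<theta> / P ^ Suc i))" for i
  have "bexp b e' < ieval F b"
  proof (rule expansion_le[OF P F, of "P * \<theta>"])
    have "P * \<theta> * ieval F P = \<zeta> * P" using w by (simp add: \<theta>_def w_def[symmetric])
    then show "Re (P * \<theta> * ieval F P) < 0" using \<zeta>(2) by (simp only:)
  qed (auto simp: e'_def)
  moreover have "P \<noteq> 0" using nonreal[of 0] by simp
  then have "e' (Suc i) = e i" for i by (simp add: e'_def e_def)
  then have "bexp b e \<le> b * bexp b e'" using bexp_Suc[OF b(1), of e'] by simp
  moreover have "b * bexp b e' < b * ieval F b" using calculation(1) b by simp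
  ultimately have "c < (b + 1) * ieval F b" using 1 by (simp add: algebra_simps)
  then show ?thesis using b by (simp add: field_simps)
qed

lemma digit_path:
  obtains F t where "F 0 = 1" "\<And>n. F (Suc n) = pCons (- t n) (F n)" "\<And>n. t n \<in> {0,1}"
    "\<And>n. F n \<in> height1" "\<And>n. \<bar>ieval (F n) b\<bar> \<le> c"
proof -
  have "bexp b (\<lambda>_. True) - 1 / (b - 1) \<le> ieval 1 b" "ieval 1 b \<le> bexp b (\<lambda>_. True)"
    using c(1) bexp_True[OF b(1)] by (simp_all add: c_def)
  from sign_coherent_expansion[OF b(1) less_imp_le[OF b(2)] one_in_height1 this]
  obtain F t where F: "F 0 = 1" "\<And>n. F (Suc n) = pCons (- t n) (F n)"
    "\<And>n. t n \<in> (if True then {0,1} else {-1,0})"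
    "\<And>n. F n \<in> height1" "\<And>n. \<bar>ieval (F n) b\<bar> \<le> 1 / (b - 1)" by metis
  show ?thesis by (rule that[of F t]) (use F in \<open>auto simp: c_def\<close>)
qed

text \<open>The remainders of the expansion of \<open>1\<close> are monic of degree \<open>n\<close>
  but take finitely many values; a coincidence gives a monic integer relation.\<close>

lemma algebraic_int_base: "algebraic_int b"
proof -
  obtain F t where F: "F 0 = 1" "\<And>n. F (Suc n) = pCons (- t n) (F n)"
    "\<And>n. F n \<in> height1" "\<And>n. \<bar>ieval (F n) b\<bar> \<le> c" using digit_path by metis
  have deg: "degree (F n) = n \<and> lead_coeff (F n) = 1" for n
  proof (induction n)
    case (Suc n)
    then have "F n \<noteq> 0" by auto
    with Suc show ?case by (auto simp: F)
  qed (simp add: F)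
  have "range (\<lambda>n. ieval (F n) b) \<subseteq> (\<lambda>F. ieval F b) ` {F \<in> height1. \<bar>ieval F b\<bar> \<le> c}"
    using F by blast
  then have "finite (range (\<lambda>n. ieval (F n) b))" using finite_spectrum by (rule finite_subset)
  then have "\<not> inj (\<lambda>n. ieval (F n) b)" using finite_imageD infinite_UNIV_nat by blast
  then obtain n m where "n < m" "ieval (F n) b = ieval (F m) b"
    unfolding inj_def by (metis linorder_neqE_nat)
  then have "ieval (F m - F n) b = 0" by simp
  moreover have "degree (F m - F n) = m"
    using degree_add_eq_right[of "- F n" "F m"] deg[of n] deg[of m] \<open>n < m\<close> by simp
  then have "lead_coeff (F m - F n) = 1"
    using deg[of n] deg[of m] \<open>n < m\<close> coeff_eq_0[of "F n" m] by auto
  ultimately show ?thesis unfolding algebraic_int_altdef_ipoly ieval_def by blast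
qed

text \<open>The remainders are bounded at \<open>r\<close> as well, so the same digits expand
  \<open>1\<close> in both bases.\<close>

lemma nonneg_real_conj:
  assumes P: "alg_conj (of_real b) (of_real r)" "1 \<le> r"
  shows "r = b"
proof (rule ccontr)
  assume "r \<noteq> b"
  have "r \<noteq> 1" using not_root_of_unity[OF P(1), of 1] by auto
  then have r: "1 < r" using P(2) by simp
  obtain F t where F: "F 0 = 1" "\<And>n. F (Suc n) = pCons (- t n) (F n)" "\<And>n. t n \<in> {0,1}"
    "\<And>n. F n \<in> height1" "\<And>n. \<bar>ieval (F n) b\<bar> \<le> c" using digit_path by metis
  obtain M where "\<And>F. F \<in> height1 \<Longrightarrow> \<bar>ieval F b\<bar> \<le> c \<Longrightarrow> norm (ieval F (of_real r :: complex)) \<le> M"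
    using conj_bounded[OF P(1)] by blast
  then have "\<bar>ieval (F n) r\<bar> \<le> M" for n using F(4,5) by (metis ieval_of_real norm_of_real)
  then have "(\<lambda>i. of_int (t i) / r ^ Suc i) sums 1"
    using bounded_expansion_sums[OF r F(1,2)] by blast
  moreover have "(\<lambda>i. of_int (t i) / b ^ Suc i) sums 1"
    using bounded_expansion_sums[OF b(1) F(1,2,5)] by blast
  ultimately show False using sums_base_unique[of r b t] sums_base_unique[of b r t] r b F(3) \<open>r \<noteq> b\<close>
    by (metis linorder_neqE_linordered_idom)
qed

text \<open>By the previous bound the orbit of 1 under \<open>v \<mapsto> b * v - 1\<close> must hit 0, so that
  \<open>b ^ m = b ^ (m - 1) + \<dots> + 1\<close>; these numbers are known to be Pisot numbers.\<close>

lemma conj_norm_less_1: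
  assumes P: "alg_conj (of_real b) P" "P \<noteq> of_real b"
  shows "norm P < 1"
proof (rule ccontr)
  assume "\<not> norm P < 1"
  then have P1: "1 \<le> norm P" by simp
  have nonreal: "P \<noteq> of_real r" if "0 \<le> r" for r
    using nonneg_real_conj[of r] P P1 that by auto
  define E :: "nat \<Rightarrow> int poly" where "E = rec_nat 1 (\<lambda>_. pCons (-1))"
  have E: "E 0 = 1" "\<And>n. E (Suc n) = pCons (-1) (E n)" by (simp_all add: E_def)
  have Eh: "E n \<in> height1" for n by (induction n) (auto simp: E one_in_height1)
  define v where "v n = ieval (E n) b" for n
  have v: "v 0 = 1" "\<And>n. v (Suc n) = b * v n - 1" by (simp_all add: v_def E)
  have vc: "c - v n = b ^ n * (c - 1)" for n
  proof (induction n)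
    case (Suc n)
    have "c - v (Suc n) = b * c - b * v n" using c(2) by (simp add: v)
    also have "\<dots> = b * (c - v n)" by (simp add: algebra_simps)
    finally show ?case using Suc by simp
  qed (simp add: v)
  \<comment> \<open>The lower bound of \<open>no_small_element\<close>. By
    \<open>b * d = c - d\<close>, the map \<open>v \<mapsto> b * v - 1\<close> sends values between
    \<open>d\<close> and \<open>c - d\<close> into \<open>{-d..d}\<close>, where \<open>0\<close> is
    the only spectrum element.\<close>
  define d where "d = c / (b + 1)"
  have d: "b * d = c - d" using b by (simp add: d_def field_simps)
  have lower: "d < \<bar>ieval G b\<bar>" if "G \<in> height1" "ieval G b \<noteq> 0" for G
    using no_small_element[OF P(1) P1 nonreal that(1)]
      no_small_element[OF P(1) P1 nonreal height1_minus[OF that(1)]] that(2)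
    by (cases "0 < ieval G b") (auto simp: d_def)
  obtain n0 where "d / (c - 1) < b ^ n0" using real_arch_pow b(1) by blast
  then have ex: "v n0 \<le> c - d" using vc[of n0] c by (simp add: pos_divide_less_eq)
  define n where "n = (LEAST n. v n \<le> c - d)"
  have n: "v n \<le> c - d" unfolding n_def using ex by (rule LeastI)
  have "0 < v n"
  proof (cases n)
    case (Suc k)
    then have "c - d < v k" unfolding n_def by (metis lessI not_le not_less_Least)
    then have "b * (c - d) - 1 < v n" using Suc b by (simp add: v)
    moreover have "b * (c - d) - 1 = d" using d c(2) by (simp add: algebra_simps)
    moreover have "0 < d" using b c by (simp add: d_def)
    ultimately show ?thesis by simp
  qed (simp add: v)
  then have "d < v n" using lower[OF Eh, of n] by (simp add: v_def)
  then have "b * d - 1 \<le> v (Suc n)" using b by (simp add: v)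
  moreover have "v (Suc n) \<le> b * (c - d) - 1" using n b by (simp add: v)
  ultimately have "\<bar>v (Suc n)\<bar> \<le> d" using d c by (simp add: algebra_simps)
  then have "ieval (E (Suc n)) b = 0" using lower[OF Eh, of "Suc n"] unfolding v_def by linarith
  then have EP0: "ieval (E (Suc n)) P = 0" using P(1) by (metis alg_conj_def ieval_of_real of_real_0)
  have EP: "ieval (E m) P = P ^ m - (\<Sum>i<m. P ^ i)" for m
  proof (induction m)
    case (Suc m)
    then show ?case
      by (simp add: E sum.lessThan_Suc_shift right_diff_distrib flip: sum_distrib_left del: sum.lessThan_Suc)
  qed (simp add: E)
  define m where "m = Suc n"
  define a where "a = norm P"
  have Pm: "P ^ m = (\<Sum>i<m. P ^ i)" using EP0 EP[of m] unfolding m_def by simp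
  have a: "1 \<le> a" using P1 by (simp add: a_def)
  have "(P - 1) * (\<Sum>i<m. P ^ i) = P ^ m - 1"
    by (simp add: power_diff_1_eq)
  then have "P ^ m * (2 - P) = 1" unfolding Pm[symmetric] by (simp add: algebra_simps)
  then have "norm (P ^ m * (2 - P)) = 1" by simp
  then have n2: "a ^ m * norm (2 - P) = 1" by (simp add: norm_mult norm_power a_def)
  \<comment> \<open>The triangle inequality in \<open>Pm\<close> yields
    \<open>norm (2 - P) \<le> 2 - norm P\<close>, an equality case that forces \<open>P\<close> to
    be a nonnegative real.\<close>
  have "a ^ m \<le> (\<Sum>i<m. a ^ i)"
    unfolding a_def norm_power[symmetric] by (subst Pm) (rule norm_sum)
  then have "(a - 1) * a ^ m \<le> (a - 1) * (\<Sum>i<m. a ^ i)" using a by (intro mult_left_mono) auto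
  also have "\<dots> = a ^ m - 1" by (simp add: power_diff_1_eq)
  finally have "a ^ m * norm (2 - P) \<le> a ^ m * (2 - a)" using n2 by (simp add: algebra_simps)
  then have "norm (2 - P) \<le> 2 - a" using a by (simp add: mult_le_cancel_left)
  moreover have "Re (2 - P) \<le> norm (2 - P)" by (rule complex_Re_le_cmod)
  ultimately have "a \<le> Re P" by simp
  moreover have "Re P \<le> a" unfolding a_def by (rule complex_Re_le_cmod)
  ultimately have "Re P = norm P" by (simp add: a_def)
  then have "Im P = 0" using cmod_power2[of P] by simp
  with \<open>Re P = norm P\<close> have "P = of_real (norm P)" by (simp add: complex_eq_iff)
  then show False using nonreal[of "norm P"] by simp
qed

end

lemma finite_spectrumI:
  fixes b :: real
  assumes b: "1 < b" "b < 2" and \<eta>: "0 < \<eta>"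
    and sep: "\<And>n x y. x \<in> dsums b n \<Longrightarrow> y \<in> dsums b n \<Longrightarrow> x < y \<Longrightarrow> \<eta> \<le> y - x"
  shows "finite_spectrum b"
proof
  fix C
  define D where "D = {y - x | x y n. x \<in> dsums b n \<and> y \<in> dsums b n \<and> 0 \<le> y - x \<and> y - x \<le> C}"
  have "finite D" unfolding D_def by (rule finite_differences_if_separated[OF b \<eta> sep])
  moreover have "(\<lambda>F. ieval F b) ` {F \<in> height1. \<bar>ieval F b\<bar> \<le> C} \<subseteq> D \<union> uminus ` D"
  proof
    fix w assume "w \<in> (\<lambda>F. ieval F b) ` {F \<in> height1. \<bar>ieval F b\<bar> \<le> C}"
    then obtain F where F: "F \<in> height1" "\<bar>ieval F b\<bar> \<le> C" "w = ieval F b" by auto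
    obtain G H where GH: "G \<in> digit_polys {0,1} (Suc (degree F))"
      "H \<in> digit_polys {0,1} (Suc (degree F))" "F = G - H"
      using digit_polys_diffE[OF height1_digit_polys[OF F(1)]] by metis
    then have m: "ieval G b \<in> dsums b (Suc (degree F))" "ieval H b \<in> dsums b (Suc (degree F))"
      by (auto simp: dsums_def)
    have w: "w = ieval G b - ieval H b" using GH(3) F(3) by simp
    show "w \<in> D \<union> uminus ` D"
    proof (cases "0 \<le> w")
      case True
      then have "w \<in> D" unfolding D_def using m w F(2,3)
        by (intro CollectI exI[of _ "ieval H b"] exI[of _ "ieval G b"] exI[of _ "Suc (degree F)"]) auto
      then show ?thesis by blast
    next
      case False
      then have "- w \<in> D" unfolding D_def using m w F(2,3)
        by (intro CollectI exI[of _ "ieval G b"] exI[of _ "ieval H b"] exI[of _ "Suc (degree F)"]) auto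
      then show ?thesis by force
    qed
  qed
  ultimately show "finite ((\<lambda>F. ieval F b) ` {F \<in> height1. \<bar>ieval F b\<bar> \<le> C})"
    by (meson finite_UnI finite_imageI finite_subset)
qed (use b in auto)

section \<open>Finitely many algebraic integers with bounded conjugates\<close>

text \<open>Any nonzero integer relation of least degree qualifies; it need not be monic or
  primitive, so divisions by it produce powers of its leading coefficient.\<close>

definition min_int_poly :: "complex \<Rightarrow> int poly \<Rightarrow> bool" where
  "min_int_poly x p \<longleftrightarrow> p \<noteq> 0 \<and> ieval p x = 0 \<and>
    (\<forall>F. F \<noteq> 0 \<longrightarrow> ieval F x = 0 \<longrightarrow> degree p \<le> degree F)"

lemma min_int_poly_exists:
  assumes "F \<noteq> 0" "ieval F x = 0"
  obtains p where "min_int_poly x p"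
  using ex_has_least_nat[of "\<lambda>F. F \<noteq> 0 \<and> ieval F x = 0" F degree] assms
  unfolding min_int_poly_def by blast

text \<open>The bound on \<open>e\<close> later provides a common denominator for all
  remainders.\<close>

lemma pseudo_division:
  fixes F g :: "int poly"
  assumes "g \<noteq> 0"
  obtains e G R where "smult (lead_coeff g ^ e) F = g * G + R" "R = 0 \<or> degree R < degree g"
    "e \<le> Suc (degree F)"
proof -
  obtain G R where GR: "pseudo_divmod F g = (G, R)" by force
  show ?thesis using pseudo_divmod[OF assms GR] that by force
qed

lemma min_int_poly_dvd:
  assumes p: "min_int_poly x p" and F: "ieval F x = 0"
  obtains e G where "smult (lead_coeff p ^ e) F = p * G"
proof -
  have "p \<noteq> 0" using p by (simp add: min_int_poly_def)
  then obtain e G R where *: "smult (lead_coeff p ^ e) F = p * G + R" "R = 0 \<or> degree R < degree p"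
    using pseudo_division by metis
  have "ieval (smult (lead_coeff p ^ e) F) x = ieval (p * G + R) x" using *(1) by simp
  then have "ieval R x = 0" using p F by (simp add: min_int_poly_def)
  then have "R = 0" using *(2) p by (auto simp: min_int_poly_def)
  then show ?thesis using that *(1) by simp
qed

lemma degree_min_int_poly: "min_int_poly x p \<Longrightarrow> 0 < degree p"
  unfolding min_int_poly_def
  by (metis degree_eq_zeroE ieval_0 ieval_pCons mult_zero_right add_0_right of_int_eq_0_iff pCons_0_0 gr0I)

lemma root_min_int_poly_zero:
  assumes p: "min_int_poly x p" and y: "ieval p y = 0" and F: "ieval F x = 0"
  shows "ieval F y = 0"
proof -
  obtain e G where "smult (lead_coeff p ^ e) F = p * G" using min_int_poly_dvd[OF p F] .
  then have "ieval (smult (lead_coeff p ^ e) F) y = ieval (p * G) y" by simp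
  then show ?thesis using y p by (simp add: min_int_poly_def)
qed

text \<open>Up to a constant, \<open>p\<close> is a product of a least relation \<open>p1\<close> of
  \<open>y\<close> and a cofactor of smaller degree than \<open>p\<close>. The cofactor cannot
  vanish at \<open>x\<close>, so \<open>p1\<close> does.\<close>

lemma root_min_int_poly:
  assumes p: "min_int_poly x p" and y: "ieval p y = 0"
  shows "alg_conj x y"
  unfolding alg_conj_def
proof (intro allI iffI)
  fix F assume F: "ieval F y = 0"
  have p0: "p \<noteq> 0" "ieval p x = 0" using p by (auto simp: min_int_poly_def)
  obtain p1 where p1: "min_int_poly y p1" using min_int_poly_exists[OF p0(1) y] .
  obtain e G where G: "smult (lead_coeff p1 ^ e) p = p1 * G" using min_int_poly_dvd[OF p1 y] .
  have l1: "lead_coeff p1 \<noteq> 0" using p1 by (simp add: min_int_poly_def)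
  then have G0: "G \<noteq> 0" using G p0(1) by (metis mult_zero_right power_not_zero smult_eq_0_iff)
  have p1_0: "p1 \<noteq> 0" using p1 by (simp add: min_int_poly_def)
  have "ieval (smult (lead_coeff p1 ^ e) p) x = ieval (p1 * G) x" using G by simp
  then have "ieval p1 x = 0 \<or> ieval G x = 0" using p0(2) by simp
  moreover have "ieval G x \<noteq> 0"
  proof
    assume "ieval G x = 0"
    then have "degree p \<le> degree G" using p G0 by (simp add: min_int_poly_def)
    moreover have "degree (smult (lead_coeff p1 ^ e) p) = degree p1 + degree G"
      unfolding G by (rule degree_mult_eq[OF p1_0 G0])
    then have "degree p = degree p1 + degree G" using l1 by simp
    ultimately show False using degree_min_int_poly[OF p1] by simp
  qed
  ultimately have "ieval p1 x = 0" by blast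
  from root_min_int_poly_zero[OF p1 this F] show "ieval F x = 0" .
qed (use root_min_int_poly_zero[OF p y] in blast)

text \<open>The roots are simple: a common root with the derivative would give \<open>x\<close> a
  relation of smaller degree. Their number then suits interpolation.\<close>

lemma finite_roots_min_int_poly:
  assumes p: "min_int_poly x p"
  defines "A \<equiv> {y :: complex. ieval p y = 0}"
  shows "finite A" "card A = degree p"
proof -
  define pc :: "complex poly" where "pc = map_poly of_int p"
  have p0: "p \<noteq> 0" using p by (simp add: min_int_poly_def)
  have deg: "degree pc = degree p" unfolding pc_def by (rule degree_map_poly) simp
  then have pc0: "pc \<noteq> 0" using degree_min_int_poly[OF p] by auto
  have A: "A = {y. poly pc y = 0}" by (simp add: A_def pc_def ieval_def)
  then show "finite A" using poly_roots_finite[OF pc0] by simp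
  have "rsquarefree pc"
    unfolding rsquarefree_roots
  proof (intro allI notI)
    fix a assume a: "poly pc a = 0 \<and> poly (pderiv pc) a = 0"
    have "pderiv pc = map_poly of_int (pderiv p)"
      by (rule poly_eqI) (simp add: pc_def coeff_pderiv coeff_map_poly)
    then have "ieval (pderiv p) a = 0" using a by (simp add: ieval_def)
    moreover have "alg_conj x a" using a by (intro root_min_int_poly[OF p]) (simp add: ieval_def pc_def)
    ultimately have "ieval (pderiv p) x = 0" by (simp add: alg_conj_def)
    moreover have "pderiv p \<noteq> 0" using degree_min_int_poly[OF p] by (simp add: pderiv_eq_0_iff)
    ultimately have "degree p \<le> degree (pderiv p)" using p by (simp add: min_int_poly_def)
    then show False using degree_min_int_poly[OF p] by (simp add: degree_pderiv)
  qed
  then have "smult (lead_coeff pc) (\<Prod>z | poly pc z = 0. [:- z, 1:]) = pc"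
    by (rule complex_poly_decompose_rsquarefree)
  then have "degree pc = degree (\<Prod>z\<in>A. [:- z, 1:])"
    using pc0 A by (metis degree_smult_eq leading_coeff_0_iff)
  also have "\<dots> = card A" by (subst degree_prod_eq_sum_degree) auto
  finally show "card A = degree p" using deg by simp
qed

text \<open>Lagrange interpolation at the points of \<open>A\<close>; \<open>L a\<close> is the
  unnormalised basis polynomial.\<close>

lemma coeff_bound_by_values:
  fixes A :: "complex set"
  assumes "finite A"
  obtains K :: "nat \<Rightarrow> real" where
    "\<And>R i. degree R < card A \<Longrightarrow> (\<And>a. a \<in> A \<Longrightarrow> norm (poly R a) \<le> B a) \<Longrightarrow> norm (coeff R i) \<le> K i"
proof -
  define L :: "complex \<Rightarrow> complex poly" where "L a = (\<Prod>b\<in>A - {a}. [:- b, 1:])" for a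
  have L0: "poly (L a) b = 0" if "a \<in> A" "b \<in> A" "a \<noteq> b" for a b
    using that assms by (auto simp: L_def poly_prod prod_zero_iff)
  have L1: "poly (L a) a \<noteq> 0" if "a \<in> A" for a
    using that assms by (auto simp: L_def poly_prod prod_zero_iff)
  have Ldeg: "degree (L a) < card A" if "a \<in> A" for a
  proof -
    have "degree (L a) = card (A - {a})" unfolding L_def by (subst degree_prod_eq_sum_degree) auto
    then show ?thesis using that assms card_gt_0_iff[of A] by (auto simp: card_Diff_singleton)
  qed
  define K where "K i = (\<Sum>a\<in>A. B a / norm (poly (L a) a) * norm (coeff (L a) i))" for i
  show ?thesis
  proof (rule that[of K])
    fix R :: "complex poly" and i
    assume R: "degree R < card A" "\<And>a. a \<in> A \<Longrightarrow> norm (poly R a) \<le> B a"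
    define S where "S = (\<Sum>a\<in>A. smult (poly R a / poly (L a) a) (L a))"
    have "poly S a = poly R a" if "a \<in> A" for a
    proof -
      have "poly S a = (\<Sum>b\<in>A. if b = a then poly R a else 0)"
        unfolding S_def poly_sum using L0 L1 that by (intro sum.cong) auto
      then show ?thesis using that assms by simp
    qed
    then have sub: "A \<subseteq> {a. poly (R - S) a = 0}" by auto
    have "degree (smult (poly R a / poly (L a) a) (L a)) \<le> card A - 1" if "a \<in> A" for a
      using Ldeg[OF that] degree_smult_le[of "poly R a / poly (L a) a" "L a"] by linarith
    then have "degree S \<le> card A - 1" unfolding S_def by (intro degree_sum_le assms)
    then have "degree (R - S) < card A" using R(1) degree_diff_le_max[of R S] by linarith
    have "R - S = 0"
    proof (rule ccontr)
      assume nz: "R - S \<noteq> 0"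
      have "card A \<le> card {a. poly (R - S) a = 0}" by (rule card_mono[OF poly_roots_finite[OF nz] sub])
      also have "\<dots> \<le> degree (R - S)" by (rule card_poly_roots_bound[OF nz])
      finally show False using \<open>degree (R - S) < card A\<close> by simp
    qed
    then have "coeff R i = coeff S i" by simp
    also have "\<dots> = (\<Sum>a\<in>A. poly R a / poly (L a) a * coeff (L a) i)"
      by (simp add: S_def coeff_sum)
    also have "norm \<dots> \<le> K i"
      unfolding K_def by (rule sum_norm_le) (auto simp: norm_mult norm_divide intro!: mult_right_mono divide_right_mono R(2))
    finally show "norm (coeff R i) \<le> K i" .
  qed
qed

lemma finite_bounded_conjugates:
  assumes h: "ieval h x = 0" "lead_coeff h = 1"
  shows "finite ((\<lambda>F. ieval F x) ` {F. \<forall>y. alg_conj x y \<longrightarrow> norm (ieval F y) \<le> B y})"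
proof -
  have h0: "h \<noteq> 0" using h(2) by auto
  obtain p where p: "min_int_poly x p" using min_int_poly_exists[OF h0 h(1)] .
  define A where "A = {y :: complex. ieval p y = 0}"
  have A: "finite A" "card A = degree p" unfolding A_def by (rule finite_roots_min_int_poly[OF p])+
  have conj: "alg_conj x y" if "y \<in> A" for y using root_min_int_poly[OF p] that by (simp add: A_def)
  have xA: "x \<in> A" using p by (simp add: A_def min_int_poly_def)
  \<comment> \<open>Reduction modulo the monic \<open>h\<close> first bounds the degree, so the
    pseudo-division by \<open>p\<close> needs at most \<open>D\<close> factors \<open>l\<close>,
    whatever the degree of \<open>F\<close>.\<close>
  define l D where "l = lead_coeff p" and "D = Suc (degree h)"
  have l: "l \<noteq> 0" using p by (simp add: l_def min_int_poly_def)
  obtain K where K: "\<And>R i. degree R < card A \<Longrightarrow>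
      (\<And>a. a \<in> A \<Longrightarrow> norm (poly R a) \<le> \<bar>of_int l\<bar> ^ D * B a) \<Longrightarrow> norm (coeff R i) \<le> K i"
    using coeff_bound_by_values[OF A(1), of "\<lambda>a. \<bar>of_int l\<bar> ^ D * B a"] by blast
  define k where "k = \<lceil>\<Sum>i<degree p. \<bar>K i\<bar>\<rceil>"
  have "ieval F x \<in> (\<lambda>R. ieval R x / of_int l ^ D) ` digit_polys {-k..k} (degree p)"
    if F: "\<forall>y. alg_conj x y \<longrightarrow> norm (ieval F y) \<le> B y" for F
  proof -
    obtain e0 G R where "smult (lead_coeff h ^ e0) F = h * G + R" and R': "R = 0 \<or> degree R < degree h"
      using pseudo_division[OF h0] by metis
    then have R: "F = h * G + R" "R = 0 \<or> degree R < degree h" using h(2) by simp_all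
    obtain e H S where S: "smult (l ^ e) R = p * H + S" "S = 0 \<or> degree S < degree p" "e \<le> Suc (degree R)"
      using pseudo_division[of p R] p unfolding l_def min_int_poly_def by metis
    have eD: "e \<le> D" using S(3) R(2) by (auto simp: D_def)
    define T where "T = smult (l ^ (D - e)) S"
    have T: "ieval T y = of_int l ^ D * ieval F y" if "y \<in> A" for y
    proof -
      have "ieval h y = 0" using conj[OF that] h(1) by (simp add: alg_conj_def)
      then have "ieval F y = ieval R y" by (simp add: R(1))
      moreover have "ieval (smult (l ^ e) R) y = ieval (p * H + S) y" using S(1) by simp
      then have "of_int l ^ e * ieval R y = ieval S y" using that by (simp add: A_def)
      ultimately have "ieval T y = of_int l ^ (D - e) * (of_int l ^ e * ieval F y)"
        by (simp add: T_def)
      also have "\<dots> = of_int l ^ D * ieval F y" using eD by (simp flip: power_add mult.assoc)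
      finally show ?thesis .
    qed
    have dT: "degree T < degree p"
      using S(2) degree_min_int_poly[OF p] degree_smult_le[of "l ^ (D - e)" S] by (auto simp: T_def)
    have "norm (coeff (map_poly of_int T :: complex poly) i) \<le> K i" for i
    proof (rule K)
      show "degree (map_poly of_int T :: complex poly) < card A"
        using dT A(2) by (simp add: degree_map_poly)
      show "norm (poly (map_poly of_int T) a) \<le> \<bar>of_int l\<bar> ^ D * B a" if "a \<in> A" for a
        using T[OF that] F conj[OF that]
        by (auto simp: ieval_def norm_mult norm_power intro!: mult_left_mono)
    qed
    then have TK: "\<bar>real_of_int (coeff T i)\<bar> \<le> K i" for i by (simp add: coeff_map_poly)
    have "\<bar>coeff T i\<bar> \<le> k" if "i < degree p" for i
    proof -
      have "\<bar>K i\<bar> \<le> (\<Sum>i<degree p. \<bar>K i\<bar>)"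
        by (rule member_le_sum) (use that in auto)
      then have "\<bar>real_of_int (coeff T i)\<bar> \<le> (\<Sum>i<degree p. \<bar>K i\<bar>)" using TK[of i] by linarith
      also have "\<dots> \<le> real_of_int k" unfolding k_def by (rule le_of_int_ceiling)
      finally have "real_of_int \<bar>coeff T i\<bar> \<le> real_of_int k" by simp
      then show ?thesis by (simp only: of_int_le_iff)
    qed
    then have "T \<in> digit_polys {-k..k} (degree p)"
      using dT by (auto simp: digit_polys_def abs_le_iff coeff_eq_0 minus_le_iff)
    moreover have "ieval F x = ieval T x / of_int l ^ D" using T[OF xA] l by simp
    ultimately show ?thesis by blast
  qed
  then have "(\<lambda>F. ieval F x) ` {F. \<forall>y. alg_conj x y \<longrightarrow> norm (ieval F y) \<le> B y}
      \<subseteq> (\<lambda>R. ieval R x / of_int l ^ D) ` digit_polys {-k..k} (degree p)" by blast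
  then show ?thesis by (rule finite_subset) (intro finite_imageI finite_digit_polys, simp)
qed

section \<open>Square roots of Pisot numbers\<close>

locale pisot_square =
  fixes q Q :: real
  assumes Q_def: "Q = q\<^sup>2"
    and q: "1 < q" "Q \<le> 2"
    and int: "algebraic_int Q"
    and conj_lt_1: "\<And>P. alg_conj (of_real Q) P \<Longrightarrow> P \<noteq> of_real Q \<Longrightarrow> norm P < 1"
    and neg_conj: "alg_conj (of_real q) (of_real (- q))"
begin

text \<open>The bound \<open>3 / 2\<close> serves to make \<open>1 / (q - 1)\<close> exceed
  \<open>2\<close>.\<close>

lemma Q: "1 < Q" "q < 3 / 2"
proof -
  show "1 < Q" using q(1) by (simp add: Q_def power2_eq_square less_1_mult)
  show "q < 3 / 2"
  proof (rule ccontr)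
    assume "\<not> q < 3 / 2"
    then have "(3 / 2)\<^sup>2 \<le> q\<^sup>2" by (intro power_mono) auto
    then show False using q(2) by (simp add: Q_def power2_eq_square)
  qed
qed

lemma independent:
  assumes "ieval F Q + q * ieval G Q = 0"
  shows "ieval F Q = 0" "ieval G Q = 0"
proof -
  define H where "H = pcompose F (monom 1 2) + monom 1 1 * pcompose G (monom 1 2)"
  have H: "ieval H x = ieval F (x\<^sup>2) + x * ieval G (x\<^sup>2)" for x :: real
    by (simp add: H_def)
  have "ieval H q = 0" using assms by (simp add: H Q_def)
  then have "ieval H (of_real q :: complex) = 0" by simp
  then have "ieval H (of_real (- q) :: complex) = 0" using neg_conj unfolding alg_conj_def by blast
  then have "ieval H (- q) = 0" unfolding ieval_of_real by simp
  then have "ieval F Q - q * ieval G Q = 0" by (simp add: H Q_def)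
  with assms have "ieval F Q = 0" "q * ieval G Q = 0" by linarith+
  then show "ieval F Q = 0" "ieval G Q = 0" using q(1) by auto
qed

text \<open>Approximating the even integers from below to within \<open>1\<close> gives pairwise
  different digit sums.\<close>

lemma card_dsums_ge: "dmax Q N / 2 \<le> card (dsums Q N)"
proof -
  define m where "m = nat \<lfloor>dmax Q N / 2\<rfloor>"
  have "\<exists>x\<in>dsums Q N. x \<le> 2 * real i \<and> 2 * real i \<le> x + 1" if "i \<le> m" for i
  proof -
    have "real i \<le> dmax Q N / 2" using that dmax_nonneg[of Q N] Q(1) by (simp add: m_def le_nat_iff le_floor_iff)
    then show ?thesis using dsums_approx[of Q "2 * real i" N] Q(1) q(2) by auto
  qed
  then obtain x where x: "\<And>i. i \<le> m \<Longrightarrow> x i \<in> dsums Q N \<and> x i \<le> 2 * real i \<and> 2 * real i \<le> x i + 1"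
    by metis
  have "inj_on x {..m}"
  proof (rule inj_onI)
    fix i j assume "i \<in> {..m}" "j \<in> {..m}" "x i = x j"
    then have "2 * real i \<le> 2 * real j + 1" "2 * real j \<le> 2 * real i + 1"
      using x[of i] x[of j] by auto
    then show "i = j" by linarith
  qed
  then have "card {..m} \<le> card (dsums Q N)"
    by (rule card_inj_on_le) (use x finite_dsums in auto)
  then have "m + 1 \<le> card (dsums Q N)" by simp
  then show ?thesis using dmax_nonneg[of Q N] Q(1) unfolding m_def by linarith
qed

text \<open>Pigeonhole: by independence the number of values \<open>x + q * y\<close> is quadratic
  in \<open>dmax Q N\<close>, while they lie in an interval of linear length.\<close>

lemma small_combination:
  assumes \<eta>: "0 < \<eta>"
  obtains n F G where "F \<in> digit_polys {-1,0,1} n" "G \<in> digit_polys {-1,0,1} n"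
    "0 < ieval F Q + q * ieval G Q" "ieval F Q + q * ieval G Q < \<eta>"
proof (rule ccontr)
  assume "\<not> thesis"
  with that have no: "\<not> (0 < ieval F Q + q * ieval G Q \<and> ieval F Q + q * ieval G Q < \<eta>)"
    if "F \<in> digit_polys {-1,0,1} n" "G \<in> digit_polys {-1,0,1} n" for F G n using that by blast
  have bound: "dmax Q N * dmax Q N / 4 \<le> (1 + q) * dmax Q N / \<eta> + 1" for N
  proof -
    define X where "X = dsums Q N"
    define f where "f = (\<lambda>(x, y). x + q * y)"
    have inj: "inj_on f (X \<times> X)"
    proof (rule inj_onI, clarify)
      fix x y x' y' assume X: "x \<in> X" "y \<in> X" "x' \<in> X" "y' \<in> X" and eq: "f (x, y) = f (x', y')"
      obtain F where F: "ieval F Q = x - x'" using dsums_diffE X unfolding X_def by metis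
      obtain G where G: "ieval G Q = y - y'" using dsums_diffE X unfolding X_def by metis
      have "ieval F Q + q * ieval G Q = 0" using eq by (simp add: F G f_def algebra_simps)
      from independent[OF this] show "x = x' \<and> y = y'" by (simp add: F G)
    qed
    have sep: "\<eta> \<le> v - u" if uv: "u \<in> f ` (X \<times> X)" "v \<in> f ` (X \<times> X)" "u < v" for u v
    proof -
      obtain x y x' y' where X: "x \<in> X" "y \<in> X" "x' \<in> X" "y' \<in> X" "u = x + q * y" "v = x' + q * y'"
        using uv(1,2) by (auto simp: f_def)
      obtain F where F: "F \<in> digit_polys {-1,0,1} N" "ieval F Q = x' - x"
        using dsums_diffE X unfolding X_def by metis
      obtain G where G: "G \<in> digit_polys {-1,0,1} N" "ieval G Q = y' - y"
        using dsums_diffE X unfolding X_def by metis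
      have "v - u = ieval F Q + q * ieval G Q" by (simp add: X F G algebra_simps)
      then show ?thesis using no[OF F(1) G(1)] uv(3) by linarith
    qed
    have "f ` (X \<times> X) \<subseteq> {0..0 + (1 + q) * dmax Q N}"
    proof
      fix w assume "w \<in> f ` (X \<times> X)"
      then obtain x y where xy: "x \<in> X" "y \<in> X" "w = x + q * y" by (auto simp: f_def)
      have "0 \<le> x" "x \<le> dmax Q N" "0 \<le> y" "y \<le> dmax Q N"
        using dsums_bounds[of Q] xy Q(1) by (auto simp: X_def)
      then have "0 \<le> w" "w \<le> dmax Q N + q * dmax Q N"
        using q(1) unfolding xy(3) by (auto intro!: add_mono mult_left_mono)
      then show "w \<in> {0..0 + (1 + q) * dmax Q N}" by (simp add: algebra_simps)
    qed
    moreover have "0 \<le> (1 + q) * dmax Q N" using q(1) dmax_nonneg[of Q N] Q(1) by simp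
    ultimately have "real (card (f ` (X \<times> X))) \<le> (1 + q) * dmax Q N / \<eta> + 1"
      using separated_card_le(2) \<eta> sep by blast
    moreover have "card (f ` (X \<times> X)) = card X * card X"
      using inj by (simp add: card_image card_cartesian_product)
    moreover have "dmax Q N / 2 * (dmax Q N / 2) \<le> real (card X) * real (card X)"
      using card_dsums_ge[of N] dmax_nonneg[of Q N] Q(1) unfolding X_def by (intro mult_mono) auto
    moreover have "dmax Q N / 2 * (dmax Q N / 2) = dmax Q N * dmax Q N / 4" by simp
    ultimately show ?thesis by (simp only: of_nat_mult)
  qed
  define K where "K = 4 * ((1 + q) / \<eta> + 1) + 1"
  have "eventually (\<lambda>N. K \<le> dmax Q N) sequentially"
    using filterlim_dmax[OF Q(1)] unfolding filterlim_at_top by blast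
  then obtain N where N: "K \<le> dmax Q N" by (auto simp: eventually_sequentially)
  define D where "D = dmax Q N"
  have "1 \<le> K" using \<eta> q(1) by (simp add: K_def)
  then have D: "1 \<le> D" using N by (simp add: D_def)
  have "D * D / 4 \<le> (1 + q) * D / \<eta> + 1" using bound[of N] by (simp add: D_def)
  also have "\<dots> \<le> (1 + q) * D / \<eta> + D" using D by simp
  also have "\<dots> = D * ((K - 1) / 4)" by (simp add: K_def algebra_simps add_divide_distrib)
  finally have "D * D \<le> D * (K - 1)" by simp
  then have "D \<le> K - 1" using D by simp
  then show False using N by (simp add: D_def)
qed

text \<open>An error has the form \<open>C0 + H * T - C\<close> with digit polynomials: at a
  conjugate inside the disc \<open>C0\<close> and \<open>C\<close> contribute \<open>u P\<close>
  each, the product \<open>u P * u P\<close>.\<close>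

lemma finite_errors:
  fixes B :: real
  defines "u \<equiv> (\<lambda>P. 1 / (1 - norm P))"
  shows "finite ((\<lambda>F. ieval F (of_real Q :: complex)) ` {F. \<bar>ieval F Q\<bar> \<le> B \<and>
    (\<forall>P. alg_conj (of_real Q) P \<longrightarrow> P \<noteq> of_real Q \<longrightarrow> norm (ieval F P) \<le> 2 * u P + u P * u P)})"
proof -
  obtain h where h: "ieval h Q = 0" "lead_coeff h = 1"
    using int unfolding algebraic_int_altdef_ipoly ieval_def by blast
  then have h': "ieval h (of_real Q :: complex) = 0" by simp
  define B' where "B' P = (if P = of_real Q then B else 2 * u P + u P * u P)" for P :: complex
  show ?thesis
    by (rule finite_subset[OF _ finite_bounded_conjugates[OF h' h(2), of B']])
      (auto simp: B'_def)
qed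

text \<open>Take a tiny \<open>\<delta> = \<alpha> + q * \<beta>\<close> and move along the points \<open>x j * (\<alpha>, \<beta>)\<close>, where the digit sums
  \<open>x j\<close> are used instead of integers because their conjugates are bounded. Rounding to pairs of
  digit sums leaves only finitely many errors, independently of \<open>\<delta>\<close>. On a set of indices with
  constant error the rounded points differ by exact multiples of \<open>\<delta>\<close>, which yields a chain of
  digit sums whose gaps are small compared with its length; it is then scaled up.\<close>

lemma dense_signed_sums: "closure (signed_sums q) = UNIV"
proof (rule dense_signed_sumsI)
  fix \<epsilon> y :: real assume \<epsilon>: "0 < \<epsilon>"
  define u where "u P = 1 / (1 - norm P)" for P :: complex
  define good where "good F \<longleftrightarrow> \<bar>ieval F Q\<bar> \<le> 5 \<and> (\<forall>P. alg_conj (of_real Q) P \<longrightarrow> P \<noteq> of_real Q \<longrightarrow>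
    norm (ieval F P) \<le> 2 * u P + u P * u P)" for F
  define E where "E = (\<lambda>F. ieval F (of_real Q :: complex)) ` {F. good F}"
  have finE: "finite E" unfolding E_def good_def u_def by (rule finite_errors)
  \<comment> \<open>Ensures that \<open>L * K\<close> indices of the scaled chain span the gap
    \<open>1\<close> left by the low digits, whichever \<open>K\<close> occurs.\<close>
  obtain L :: nat where L: "3 / \<epsilon> \<le> real L" using real_arch_simple by blast
  obtain R where R: "\<And>(col :: nat \<Rightarrow> complex \<times> complex) s. card (col ` {s..s + R}) \<le> card (E \<times> E) \<Longrightarrow>
    \<exists>K u a. 1 \<le> K \<and> K \<le> R \<and> s \<le> u \<and> u + L * K + K \<le> s + R \<and>
      (\<forall>t\<in>{u..u + L * K}. \<exists>j\<in>{t..t + K}. col j = a)"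
    using monochromatic_syndetic[where r = "card (E \<times> E)" and L = L and 'c = "complex \<times> complex"] by blast
  have dmax_q: "dmax q (2 * k) = (Q ^ k - 1) / (q - 1)" for k
    using q(1) by (simp add: dmax_eq Q_def power_mult)
  have "2 < 1 / (q - 1)" using q(1) Q(2) by (simp add: field_simps)
  \<comment> \<open>The \<open>2 * k\<close> low digits must reach the target \<open>s\<close>
    below, which differs from half of \<open>dmax q (2 * k)\<close> by \<open>y / 2\<close>, an
    offset of at most \<open>Q ^ k\<close> and a shift of at most
    \<open>real R * \<epsilon>\<close>.\<close>
  obtain k0 where k0: "\<And>k. k0 \<le> k \<Longrightarrow> \<bar>y\<bar> + 2 * Q ^ k \<le> dmax q (2 * k)"
    "\<And>k. k0 \<le> k \<Longrightarrow> \<bar>y\<bar> + 2 * real R * \<epsilon> \<le> dmax q (2 * k)"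
  proof -
    define w where "w = 1 / (q - 1) - 2"
    have w: "0 < w" using \<open>2 < 1 / (q - 1)\<close> by (simp add: w_def)
    have "filterlim (\<lambda>k. Q ^ k) at_top sequentially"
      using Q(1) by real_asymp
    then have "eventually (\<lambda>k. max ((\<bar>y\<bar> + 1 / (q - 1)) / w) (real R * \<epsilon>) \<le> Q ^ k) sequentially"
      unfolding filterlim_at_top by blast
    then obtain k0 where k0: "\<And>k. k0 \<le> k \<Longrightarrow> (\<bar>y\<bar> + 1 / (q - 1)) / w \<le> Q ^ k \<and> real R * \<epsilon> \<le> Q ^ k"
      by (auto simp: eventually_sequentially)
    have 1: "\<bar>y\<bar> + 2 * Q ^ k \<le> dmax q (2 * k)" if "k0 \<le> k" for k
    proof -
      have "\<bar>y\<bar> + 1 / (q - 1) \<le> Q ^ k * w" using k0[OF that] w by (simp add: pos_divide_le_eq)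
      moreover have "dmax q (2 * k) = Q ^ k * (1 / (q - 1)) - 1 / (q - 1)"
        by (simp add: dmax_q diff_divide_distrib)
      ultimately show ?thesis by (simp add: w_def algebra_simps)
    qed
    have 2: "\<bar>y\<bar> + 2 * real R * \<epsilon> \<le> dmax q (2 * k)" if "k0 \<le> k" for k
      using 1[OF that] k0[OF that] by linarith
    show ?thesis by (rule that[OF 1 2])
  qed
  \<comment> \<open>Makes the scaled gap at exponent \<open>k0\<close> at most
    \<open>\<epsilon>\<close> for every \<open>K \<le> R\<close>, before \<open>K\<close> is
    known.\<close>
  define \<eta> where "\<eta> = \<epsilon> / (4 * (real R + 1) * Q ^ k0)"
  have \<eta>: "0 < \<eta>" using \<epsilon> Q(1) by (simp add: \<eta>_def)
  obtain n F G where FG: "F \<in> digit_polys {-1,0,1} n" "G \<in> digit_polys {-1,0,1} n"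
    "0 < ieval F Q + q * ieval G Q" "ieval F Q + q * ieval G Q < \<eta>"
    using small_combination[OF \<eta>] .
  define \<alpha> \<beta> \<delta> where "\<alpha> = ieval F Q" and "\<beta> = ieval G Q" and "\<delta> = \<alpha> + q * \<beta>"
  have \<delta>: "0 < \<delta>" "\<delta> < \<eta>" using FG by (auto simp: \<alpha>_def \<beta>_def \<delta>_def)
  have approx: "\<exists>G\<in>digit_polys {0,1} n. ieval G Q \<le> s \<and> s \<le> ieval G Q + 1"
    if "0 \<le> s" "s \<le> dmax Q n" for s n
    using dsums_approx[OF Q(1) q(2) that] unfolding dsums_def by blast
  have large: "\<exists>N. C \<le> dmax Q N" for C
  proof -
    have "eventually (\<lambda>N. C \<le> dmax Q N) sequentially"
      using filterlim_dmax[OF Q(1)] unfolding filterlim_at_top by blast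
    then show ?thesis by (auto simp: eventually_sequentially)
  qed
  obtain M where M: "3 * real R \<le> dmax Q M" using large by blast
  have "\<exists>H. j \<le> R \<longrightarrow> H \<in> digit_polys {0,1} M \<and> ieval H Q \<le> 3 * real j \<and> 3 * real j \<le> ieval H Q + 1" for j
    using approx[of "3 * real j" M] M by (cases "j \<le> R") auto
  then obtain H where H: "\<And>j. j \<le> R \<Longrightarrow> H j \<in> digit_polys {0,1} M"
    "\<And>j. j \<le> R \<Longrightarrow> ieval (H j) Q \<le> 3 * real j" "\<And>j. j \<le> R \<Longrightarrow> 3 * real j \<le> ieval (H j) Q + 1"
    by metis
  define x where "x j = ieval (H j) Q" for j
  have x: "0 \<le> x j" "x j \<le> 3 * real R" "x j \<le> 3 * real j" "3 * real j - 1 \<le> x j" if "j \<le> R" for j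
    using H[OF that] dsums_bounds(1)[of Q "x j" M] that Q(1) by (auto simp: x_def dsums_def)
  define \<rho> where "\<rho> = 3 * real R * \<bar>\<beta>\<bar>"
  have \<rho>: "\<bar>x j * \<beta>\<bar> \<le> \<rho>" if "j \<le> R" for j
    using x[OF that] by (auto simp: \<rho>_def abs_mult intro!: mult_right_mono)
  obtain N where N: "2 * (2 * (2 + \<rho>) + 3 * real R * \<delta> + 2) \<le> dmax Q N" using large by blast
  define D where "D = dmax Q N"
  have \<rho>0: "0 \<le> \<rho>" by (simp add: \<rho>_def)
  define w where "w = 3 * real R * \<delta>"
  have D: "2 * (2 * (2 + \<rho>) + w + 2) \<le> D" "0 \<le> w"
    using N \<delta> by (simp_all add: D_def w_def)
  have D0: "0 \<le> D / 2" "D / 2 \<le> D" "2 + \<rho> \<le> D / 2" "2 * (2 + \<rho>) + w \<le> D / 2"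
    using D \<rho>0 by auto
  have approxN: "\<exists>G\<in>digit_polys {0,1} N. ieval G Q \<le> s \<and> s \<le> ieval G Q + 1"
    if "0 \<le> s" "s \<le> D" for s using approx that unfolding D_def by blast
  \<comment> \<open>The middle of the range of \<open>x + q * y\<close> over digit sums with
    \<open>N\<close> digits. Room is needed on both sides, as \<open>\<beta>\<close> has unknown
    sign and may be far larger than \<open>\<delta>\<close>.\<close>
  define cent where "cent = (1 + q) * D / 2"
  have cent: "cent = D / 2 + q * (D / 2)" by (simp add: cent_def algebra_simps add_divide_distrib)
  obtain B0 where B0: "B0 \<in> digit_polys {0,1} N" "ieval B0 Q \<le> D / 2" "D / 2 \<le> ieval B0 Q + 1"
    using approxN[of "D / 2"] D0 by blast
  have q2: "q * s \<le> 2 * s" if "0 \<le> s" for s using Q(2) that by (intro mult_right_mono) auto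
  have q0: "0 \<le> q * s" if "0 \<le> s" for s using q(1) that by simp
  have qB0: "cent - q * ieval B0 Q = D / 2 + q * (D / 2 - ieval B0 Q)" by (simp add: cent algebra_simps)
  have "0 \<le> q * (D / 2 - ieval B0 Q)" "q * (D / 2 - ieval B0 Q) \<le> 2"
    using B0 q0[of "D / 2 - ieval B0 Q"] q2[of "D / 2 - ieval B0 Q"] by auto
  then have "0 \<le> cent - q * ieval B0 Q" "cent - q * ieval B0 Q \<le> D"
    unfolding qB0 using D0 \<rho>0 by linarith+
  then obtain A0 where A0: "A0 \<in> digit_polys {0,1} N" "ieval A0 Q \<le> cent - q * ieval B0 Q"
    "cent - q * ieval B0 Q \<le> ieval A0 Q + 1" using approxN by blast
  have "\<exists>B. j \<le> R \<longrightarrow> B \<in> digit_polys {0,1} N \<and> ieval B Q \<le> ieval B0 Q + x j * \<beta> \<and>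
      ieval B0 Q + x j * \<beta> \<le> ieval B Q + 1" for j
  proof (cases "j \<le> R")
    case True
    then have "0 \<le> ieval B0 Q + x j * \<beta>" "ieval B0 Q + x j * \<beta> \<le> D"
      using \<rho>[OF True] D0 \<rho>0 B0 unfolding abs_le_iff by linarith+
    then show ?thesis using approxN by blast
  qed auto
  then obtain B where B: "\<And>j. j \<le> R \<Longrightarrow> B j \<in> digit_polys {0,1} N"
    "\<And>j. j \<le> R \<Longrightarrow> ieval (B j) Q \<le> ieval B0 Q + x j * \<beta>"
    "\<And>j. j \<le> R \<Longrightarrow> ieval B0 Q + x j * \<beta> \<le> ieval (B j) Q + 1"
    by metis
  \<comment> \<open>The odd part was rounded first; the even part absorbs its error as well, so the
    combined point errs by at most \<open>1\<close>.\<close>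
  have "\<exists>A. j \<le> R \<longrightarrow> A \<in> digit_polys {0,1} N \<and> ieval A Q \<le> cent + x j * \<delta> - q * ieval (B j) Q \<and>
      cent + x j * \<delta> - q * ieval (B j) Q \<le> ieval A Q + 1" for j
  proof (cases "j \<le> R")
    case True
    have eq: "cent + x j * \<delta> - q * ieval (B j) Q = D / 2 + q * (D / 2 - ieval (B j) Q) + x j * \<delta>"
      by (simp add: cent algebra_simps)
    have "- \<rho> \<le> D / 2 - ieval (B j) Q" "D / 2 - ieval (B j) Q \<le> 2 + \<rho>"
      using B[OF True] B0 \<rho>[OF True] by (auto simp: abs_le_iff)
    define p where "p = q * (D / 2 - ieval (B j) Q)"
    have "q * (- \<rho>) \<le> p" "p \<le> q * (2 + \<rho>)"
      unfolding p_def using q(1) \<open>- \<rho> \<le> D / 2 - ieval (B j) Q\<close> \<open>D / 2 - ieval (B j) Q \<le> 2 + \<rho>\<close>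
      by (meson mult_left_mono less_imp_le less_trans zero_less_one)+
    moreover have "q * (2 + \<rho>) \<le> 2 * (2 + \<rho>)" by (intro q2, use \<rho>0 in simp)
    moreover have "q * (- \<rho>) = - (q * \<rho>)" "q * \<rho> \<le> 2 * \<rho>" using q2[OF \<rho>0] by simp_all
    ultimately have p: "- (2 * \<rho>) \<le> p" "p \<le> 2 * (2 + \<rho>)" by simp_all
    have "0 \<le> x j * \<delta>" "x j * \<delta> \<le> w"
      unfolding w_def using x[OF True] \<delta> by (auto intro!: mult_right_mono)
    with p have "0 \<le> cent + x j * \<delta> - q * ieval (B j) Q" "cent + x j * \<delta> - q * ieval (B j) Q \<le> D"
      unfolding eq p_def[symmetric] using D0 by simp_all
    then show ?thesis using approxN by blast
  qed auto
  then obtain A where A: "\<And>j. j \<le> R \<Longrightarrow> A j \<in> digit_polys {0,1} N"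
    "\<And>j. j \<le> R \<Longrightarrow> ieval (A j) Q \<le> cent + x j * \<delta> - q * ieval (B j) Q"
    "\<And>j. j \<le> R \<Longrightarrow> cent + x j * \<delta> - q * ieval (B j) Q \<le> ieval (A j) Q + 1"
    by metis
  \<comment> \<open>Rounding errors, kept as polynomials so that they can be bounded at every
    conjugate.\<close>
  define f g where "f j = A0 + H j * F - A j" and "g j = B0 + H j * G - B j" for j
  have conj_bound: "norm (ieval (C0 + H j * T - C) P) \<le> 2 * u P + u P * u P"
    if "C0 \<in> digit_polys {0,1} N" "C \<in> digit_polys {0,1} N" "T \<in> digit_polys {-1,0,1} n" "j \<le> R"
      "alg_conj (of_real Q) P" "P \<noteq> of_real Q" for C0 C T j P
  proof -
    have P: "norm P < 1" using conj_lt_1 that(5,6) by blast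
    have sub: "digit_polys {0,1} m \<subseteq> digit_polys {-1,0,1} m" for m by (rule digit_polys_mono) auto
    have n: "norm (ieval C0 P) \<le> u P" "norm (ieval C P) \<le> u P" "norm (ieval T P) \<le> u P"
      "norm (ieval (H j) P) \<le> u P"
      using norm_digit_poly_le[OF _ P] that(1-4) H(1) sub unfolding u_def by blast+
    have "norm (ieval (C0 + H j * T - C) P) \<le> norm (ieval C0 P + ieval (H j) P * ieval T P) + norm (ieval C P)"
      using norm_triangle_ineq4 by simp
    also have "norm (ieval C0 P + ieval (H j) P * ieval T P) \<le> norm (ieval C0 P) + norm (ieval (H j) P) * norm (ieval T P)"
      by (metis norm_mult norm_triangle_ineq)
    also have "\<dots> \<le> u P + u P * u P" using n by (intro add_mono mult_mono) (auto intro: order_trans[OF norm_ge_zero])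
    finally show ?thesis using n(2) by simp
  qed
  have goodf: "good (f j)" if "j \<le> R" for j
    unfolding good_def
  proof (intro conjI allI impI)
    have eq: "ieval (f j) Q = (ieval A0 Q - (cent - q * ieval B0 Q)) +
        (cent + x j * \<delta> - q * ieval (B j) Q - ieval (A j) Q) - q * (ieval B0 Q + x j * \<beta> - ieval (B j) Q)"
      by (simp add: f_def x_def \<delta>_def \<alpha>_def[symmetric] algebra_simps)
    have "q * (ieval B0 Q + x j * \<beta> - ieval (B j) Q) \<le> 2 * 1"
      using B[OF that] q(1) Q(2) by (intro mult_mono) auto
    moreover have "0 \<le> q * (ieval B0 Q + x j * \<beta> - ieval (B j) Q)" using B[OF that] by (intro q0) simp
    ultimately show "\<bar>ieval (f j) Q\<bar> \<le> 5" unfolding eq using A0 A[OF that] by linarith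
  next
    fix P assume "alg_conj (of_real Q) P" "P \<noteq> of_real Q"
    then show "norm (ieval (f j) P) \<le> 2 * u P + u P * u P"
      unfolding f_def by (rule conj_bound[OF A0(1) A(1)[OF that] FG(1) that])
  qed
  have goodg: "good (g j)" if "j \<le> R" for j
    unfolding good_def
  proof (intro conjI allI impI)
    have "ieval (g j) Q = ieval B0 Q + x j * \<beta> - ieval (B j) Q"
      by (simp add: g_def x_def \<beta>_def)
    then show "\<bar>ieval (g j) Q\<bar> \<le> 5" using B[OF that] by linarith
  next
    fix P assume "alg_conj (of_real Q) P" "P \<noteq> of_real Q"
    then show "norm (ieval (g j) P) \<le> 2 * u P + u P * u P"
      unfolding g_def by (rule conj_bound[OF B0(1) B(1)[OF that] FG(2) that])
  qed
  define col where "col j = (ieval (f j) (of_real Q :: complex), ieval (g j) (of_real Q :: complex))" for j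
  have "col ` {0..0 + R} \<subseteq> E \<times> E" using goodf goodg by (auto simp: col_def E_def)
  then have "card (col ` {0..0 + R}) \<le> card (E \<times> E)" using finE by (intro card_mono) auto
  from R[OF this] obtain K v a where K': "1 \<le> K" "K \<le> R" "v + L * K + K \<le> 0 + R"
    and syn': "\<forall>t\<in>{v..v + L * K}. \<exists>j\<in>{t..t + K}. col j = a" by blast
  then have K: "1 \<le> K" "K \<le> R" "v + L * K + K \<le> R" by simp_all
  have syn: "\<exists>j\<in>{t..t + K}. col j = a" if "v \<le> t" "t \<le> v + L * K" for t
    using syn' that by simp
  define e where "e j = ieval (A j) Q + q * ieval (B j) Q" for j
  have e_eq: "e j = (ieval A0 Q + q * ieval B0 Q + x j * \<delta>) - (ieval (f j) Q + q * ieval (g j) Q)" for j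
    by (simp add: e_def f_def g_def x_def \<delta>_def \<alpha>_def \<beta>_def algebra_simps)
  obtain j1 where j1: "j1 \<in> {v..v + K}" "col j1 = a" using syn[of v] by auto
  define E0 where "E0 = e j1 - x j1 * \<delta>"
  have e_col: "e j = E0 + x j * \<delta>" if "col j = a" for j
  proof -
    have "ieval (f j) Q = ieval (f j1) Q" "ieval (g j) Q = ieval (g j1) Q"
      using trans[OF that j1(2)[symmetric]] by (simp_all add: col_def)
    then show ?thesis by (simp add: E0_def e_eq)
  qed
  have "j1 \<le> R" using j1(1) K(3) by simp
  then have E0: "cent - 1 \<le> E0" "E0 \<le> cent" using A[of j1] by (auto simp: E0_def e_def)
  have e_mem: "e j \<in> dsums q (2 * N)" if "j \<le> R" for j
    using A(1)[OF that] B(1)[OF that] unfolding e_def Q_def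
    by (intro dsums_even_odd) (auto simp: dsums_def)
  have "Q ^ k0 * (4 * real K * \<delta>) \<le> \<epsilon>"
  proof -
    have "4 * real K * \<delta> \<le> 4 * (real R + 1) * \<eta>" using K \<delta> by (intro mult_mono) auto
    also have "\<dots> = \<epsilon> / Q ^ k0" by (simp add: \<eta>_def)
    finally show ?thesis using Q(1) by (simp add: field_simps)
  qed
  then obtain k where k: "k0 \<le> k" "Q ^ k * (4 * real K * \<delta>) \<le> \<epsilon>" "\<epsilon> < Q * (Q ^ k * (4 * real K * \<delta>))"
    using scale_into_interval[OF Q(1), of "4 * real K * \<delta>" k0 \<epsilon>] K(1) \<delta>(1) by auto
  define \<gamma> where "\<gamma> = Q ^ k * \<delta>"
  have \<gamma>: "0 < \<gamma>" "4 * (real K * \<gamma>) \<le> \<epsilon>" "\<epsilon> \<le> 8 * (real K * \<gamma>)"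
  proof -
    show "0 < \<gamma>" using Q(1) \<delta> by (simp add: \<gamma>_def)
    show "4 * (real K * \<gamma>) \<le> \<epsilon>" using k(2) by (simp add: \<gamma>_def mult_ac)
    have "Q * (Q ^ k * (4 * real K * \<delta>)) \<le> 2 * (Q ^ k * (4 * real K * \<delta>))"
      using q(2) Q(1) \<delta> by (intro mult_right_mono) auto
    then show "\<epsilon> \<le> 8 * (real K * \<gamma>)" using k(3) by (simp add: \<gamma>_def mult_ac)
  qed
  have \<gamma>1: "\<gamma> \<le> real K * \<gamma>" using K(1) \<gamma>(1) by simp
  define c2 where "c2 = dmax q (2 * k)"
  define \<tau> where "\<tau> = (y + dmax q (2 * k + 2 * N)) / 2"
  have \<tau>: "\<tau> = y / 2 + c2 / 2 + Q ^ k * cent"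
    by (simp add: \<tau>_def c2_def dmax_add dmax_even[of q N] cent_def D_def Q_def[symmetric] power_mult
        add_divide_distrib)
  \<comment> \<open>The part of the target left to the low digits when the chain is entered at index
    \<open>v\<close>, whose scaled position is about \<open>3 * real v * \<gamma>\<close>.\<close>
  define s where "s = \<tau> - Q ^ k * E0 - 3 * real v * \<gamma>"
  have "Q ^ k * (cent - E0) \<le> Q ^ k * 1" "0 \<le> Q ^ k * (cent - E0)"
    using E0 Q(1) by (auto intro!: mult_left_mono)
  moreover have s_eq: "s = y / 2 + c2 / 2 + Q ^ k * (cent - E0) - 3 * real v * \<gamma>"
    by (simp add: s_def \<tau> algebra_simps)
  moreover have "3 * real v * \<gamma> \<le> real R * \<epsilon>"
  proof -
    have "3 * \<gamma> \<le> \<epsilon>" using \<gamma> \<gamma>1 by linarith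
    moreover have "real v \<le> real R" using K(3) by simp
    ultimately have "real v * (3 * \<gamma>) \<le> real R * \<epsilon>" using \<gamma>(1) by (intro mult_mono) auto
    then show ?thesis by (simp add: mult_ac)
  qed
  moreover have "0 \<le> 3 * real v * \<gamma>" using \<gamma>(1) by simp
  ultimately have "0 \<le> s" "s \<le> c2" using k0[OF k(1)] unfolding c2_def[symmetric]
    by (auto simp: abs_if algebra_simps split: if_splits)
  then obtain z where z: "z \<in> dsums q (2 * k)" "z \<le> s" "s \<le> z + 1"
    using dsums_approx[OF q(1), of s "2 * k"] Q(2) unfolding c2_def by auto
  \<comment> \<open>Moving \<open>m\<close> indices along covers the defect \<open>s - z\<close> up
    to \<open>3 * \<gamma>\<close>; the next index of the right colour is at most \<open>K\<close>
    further on.\<close>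
  define m where "m = nat \<lfloor>(s - z) / (3 * \<gamma>)\<rfloor>"
  have m: "real m * (3 * \<gamma>) \<le> s - z" "s - z \<le> real m * (3 * \<gamma>) + 3 * \<gamma>"
  proof -
    have "0 \<le> (s - z) / (3 * \<gamma>)" using z(2) \<gamma>(1) by simp
    then have "real m \<le> (s - z) / (3 * \<gamma>)" "(s - z) / (3 * \<gamma>) \<le> real m + 1"
      unfolding m_def by linarith+
    then show "real m * (3 * \<gamma>) \<le> s - z" "s - z \<le> real m * (3 * \<gamma>) + 3 * \<gamma>"
      using \<gamma>(1) by (simp_all add: field_simps)
  qed
  have "m \<le> L * K"
  proof -
    have "3 \<le> real L * \<epsilon>" using L \<epsilon> by (simp add: field_simps)
    also have "\<dots> \<le> real L * (8 * (real K * \<gamma>))" using \<gamma>(3) by (intro mult_left_mono) auto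
    finally have "1 \<le> real (L * K) * (3 * \<gamma>)" by simp
    then have "real m * (3 * \<gamma>) \<le> real (L * K) * (3 * \<gamma>)" using m(1) z(3) by linarith
    then have "real m \<le> real (L * K)" using \<gamma>(1) by (intro mult_right_le_imp_le[of "real m" "3 * \<gamma>"]) auto
    then show ?thesis by (simp only: of_nat_le_iff)
  qed
  then obtain j where j: "j \<in> {v + m..v + m + K}" "col j = a" using syn[of "v + m"] by auto
  have jR: "j \<le> R" using j(1) \<open>m \<le> L * K\<close> K(3) by simp
  have qk: "q ^ (2 * k) = Q ^ k" by (simp add: Q_def power_mult)
  have mem: "z + q ^ (2 * k) * e j \<in> dsums q (2 * k + 2 * N)" by (intro dsums_append z e_mem jR)
  have eq: "z + q ^ (2 * k) * e j - \<tau> = x j * \<gamma> - 3 * real v * \<gamma> - (s - z)"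
    unfolding qk e_col[OF j(2)] s_def \<gamma>_def by (simp add: algebra_simps)
  have "x j * \<gamma> \<le> (3 * (real v + real m + real K)) * \<gamma>"
    using x(3)[OF jR] j(1) \<gamma>(1) by (intro mult_right_mono) auto
  also have "\<dots> = 3 * real v * \<gamma> + real m * (3 * \<gamma>) + 3 * (real K * \<gamma>)" by (simp add: algebra_simps)
  finally have upper: "x j * \<gamma> \<le> 3 * real v * \<gamma> + real m * (3 * \<gamma>) + 3 * (real K * \<gamma>)" .
  have "3 * real v * \<gamma> + real m * (3 * \<gamma>) - \<gamma> = (3 * (real v + real m) - 1) * \<gamma>" by (simp add: algebra_simps)
  also have "\<dots> \<le> x j * \<gamma>"
    using x(4)[OF jR] j(1) \<gamma>(1) by (intro mult_right_mono) auto
  finally have lower: "3 * real v * \<gamma> + real m * (3 * \<gamma>) - \<gamma> \<le> x j * \<gamma>" .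
  have "\<bar>z + q ^ (2 * k) * e j - \<tau>\<bar> \<le> 4 * (real K * \<gamma>)"
    unfolding eq by (rule abs_leI) (use upper lower m \<gamma>1 \<gamma>(1) in linarith)+
  then have "\<bar>z + q ^ (2 * k) * e j - \<tau>\<bar> \<le> \<epsilon>" using \<gamma>(2) by linarith
  moreover have "0 < 2 * k + 2 * N"
  proof -
    have "0 < D" using D \<rho>0 by auto
    then have "N \<noteq> 0" unfolding D_def by (metis dmax_0 less_irrefl)
    then show ?thesis by simp
  qed
  ultimately show "\<exists>n>0. \<exists>x\<in>dsums q n. \<bar>x - (y + dmax q n) / 2\<bar> \<le> \<epsilon>"
    using mem unfolding \<tau>_def by blast
qed

end

theorem theorem1p5:
  fixes q :: real
  assumes "1 < q" and "q \<le> sqrt 2" and "\<not> pisot q"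
  shows "closure (signed_sums q) = (UNIV :: real set)"
proof (rule ccontr)
  assume not_dense: "closure (signed_sums q) \<noteq> UNIV"
  define Q where "Q = q\<^sup>2"
  have "q\<^sup>2 \<le> (sqrt 2)\<^sup>2" using assms(1,2) by (intro power_mono) auto
  then have Q: "1 < Q" "Q \<le> 2" using assms(1) by (simp_all add: Q_def)
  obtain \<eta> where \<eta>: "0 < \<eta>"
    "\<And>n x y. x \<in> dsums Q n \<Longrightarrow> y \<in> dsums Q n \<Longrightarrow> x < y \<Longrightarrow> \<eta> \<le> y - x"
    using dense_if_small_even_differences[OF assms(1)] Q(2) not_dense unfolding Q_def
    by (metis diff_gt_0_iff_gt not_le)
  have Q_pisot: "algebraic_int Q \<and> (\<forall>P. alg_conj (of_real Q) P \<longrightarrow> P \<noteq> of_real Q \<longrightarrow> norm P < 1)"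
  proof (cases "Q = 2")
    case True
    have "P = 2" if "alg_conj 2 P" for P
      using that[unfolded alg_conj_def, rule_format, of "[:-2, 1:]"] by simp
    with True show ?thesis by auto
  next
    case False
    then interpret finite_spectrum Q
      using Q \<eta> by (intro finite_spectrumI) auto
    show ?thesis using algebraic_int_base conj_norm_less_1 by blast
  qed
  \<comment> \<open>With \<open>q\<close> an algebraic integer, the Pisot condition can fail only
    through a further conjugate outside the open unit disc.\<close>
  have "algebraic_int (sqrt Q)" using Q_pisot by blast
  then have "algebraic_int q" using assms(1) by (simp add: Q_def)
  then obtain z where z: "z \<in> conjugates (of_real q)" "z \<noteq> of_real q" "\<not> norm z < 1"
    using assms(1,3) unfolding pisot_def by auto
  have conj: "alg_conj (of_real q) z" by (rule conjugates_imp_alg_conj[OF z(1)])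
  have "z\<^sup>2 = of_real Q"
  proof (rule ccontr)
    assume "z\<^sup>2 \<noteq> of_real Q"
    then have "norm (z\<^sup>2) < 1"
      using Q_pisot alg_conj_power2[OF conj] by (simp add: Q_def)
    then show False using z(3) by (simp add: norm_power power_less_one_iff abs_square_less_1)
  qed
  then have "z = of_real (- q)" using z(2) by (simp add: Q_def power2_eq_iff)
  then have "pisot_square q Q"
    using assms(1) Q Q_pisot conj by unfold_locales (auto simp: Q_def)
  then show False using not_dense pisot_square.dense_signed_sums by blast
qed

end
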